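(* Let $M\ge 2$ be an integer and let $E\subset[0,1]^2$ be the planar fractal percolation with parameters $M,p$. For every $0<p\le 1$, for almost every realization of $E$ conditioned on $E\neq\emptyset$, the following holds simultaneously for all straight lines $\ell\subset\mathbb{R}^2$ which are not parallel to the coordinate axes: $$\dim_{\rm H}(E_\ell)=\min\{1,\dim_{\rm H}(E)\},$$ where $E_\ell$ denotes the orthogonal projection of $E$ to the line $\ell$ and $\dim_{\rm H}$ is Hausdorff dimension.
   Context: Planar fractal (Mandelbrot) percolation with parameters $M,p$: the closed unit square $K=[0,1]^2$ is divided into $M^2$ congruent closed squares of side $M^{-1}$; each is retained with probability $p$ and discarded with probability $1-p$, independently. $E_1$ is the union of retained squares. Each retained square is divided into $M^2$ congruent closed squares of side $M^{-2}$, each retained with probability $p$ independently of everything else; $E_2$ is the union of the retained level-2 squares; and so on ad infinitum. Then $E:=\bigcap_{n\ge1}E_n$. "For almost every realization conditioned on $E\ne\emptyset$" means: outside an event of probability zero, whenever $E\neq\emptyset$. *)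

theory Defs
  imports "HOL-Probability.Probability"
begin

section \<open>Hausdorff measure and Hausdorff dimension\<close>

text \<open>
  The \<open>s\<close>-th power of the diameter, with the conventions that the empty set contributes 0
  and that \<open>0\<^sup>0 = 1\<close> for nonempty sets (in the library \<open>0 powr 0 = 0\<close>).
\<close>

definition diam_pow :: "real \<Rightarrow> 'a::metric_space set \<Rightarrow> ennreal" where
  "diam_pow s C =
     (if C = {} then 0 else if s = 0 then 1 else ennreal (diameter C powr s))"

text \<open>
  The sets of a cover are required to be bounded since \<^const>\<open>diameter\<close> is unspecified on
  unbounded sets. Finite covers are included, by padding with the empty set.
\<close>

definition hausdorff_pre_measure :: "real \<Rightarrow> real \<Rightarrow> 'a::metric_space set \<Rightarrow> ennreal" where
  "hausdorff_pre_measure \<delta> s A =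
     (INF C \<in> {C :: nat \<Rightarrow> 'a set. A \<subseteq> (\<Union>k. C k) \<and> (\<forall>k. bounded (C k) \<and> diameter (C k) \<le> \<delta>)}.
        \<Sum>k. diam_pow s (C k))"

definition hausdorff_measure :: "real \<Rightarrow> 'a::metric_space set \<Rightarrow> ennreal" where
  "hausdorff_measure s A = (SUP \<delta> \<in> {0<..}. hausdorff_pre_measure \<delta> s A)"

definition hausdorff_dim :: "'a::metric_space set \<Rightarrow> ennreal" where
  "hausdorff_dim A = (INF s \<in> {s. 0 \<le> s \<and> hausdorff_measure s A = 0}. ennreal s)"


section \<open>Lines and orthogonal projections\<close>

definition is_line :: "'a::euclidean_space set \<Rightarrow> bool" where
  "is_line L \<longleftrightarrow> affine L \<and> aff_dim L = 1"

definition orth_proj :: "'a::euclidean_space set \<Rightarrow> 'a \<Rightarrow> 'a" where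
  "orth_proj L x = (THE y. y \<in> L \<and> (\<forall>u\<in>L. \<forall>v\<in>L. orthogonal (x - y) (u - v)))"

lemma orth_proj_ex1:
  fixes L :: "'a::euclidean_space set"
  assumes "affine L" "L \<noteq> {}"
  shows "\<exists>!y. y \<in> L \<and> (\<forall>u\<in>L. \<forall>v\<in>L. orthogonal (x - y) (u - v))"
proof -
  obtain a where a: "a \<in> L" using assms by blast
  define S where "S = {u - a | u. u \<in> L}"
  have sub: "subspace S"
    using affine_diffs_subspace_subtract[OF assms(1) a] by (simp add: S_def Setcompr_eq_image)
  obtain s w where s: "s \<in> span S" and w: "\<And>t. t \<in> span S \<Longrightarrow> orthogonal w t"
    and e: "x - a = s + w"
    using orthogonal_subspace_decomp_exists[of S "x - a"] by blast
  have sS: "s \<in> S" using s sub by (metis span_eq_iff)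
  then have yL: "a + s \<in> L" by (auto simp: S_def)
  have xy: "x - (a + s) = w" using e by (simp add: algebra_simps)
  have o: "orthogonal w (u - v)" if "u \<in> L" "v \<in> L" for u v
  proof -
    have "u - a \<in> S" "v - a \<in> S" using that by (auto simp: S_def)
    then have "(u - a) - (v - a) \<in> S" using subspace_diff[OF sub] by blast
    then show ?thesis using w[of "u - v"] by (simp add: span_base)
  qed
  show ?thesis
  proof (rule ex1I[of _ "a + s"])
    show "a + s \<in> L \<and> (\<forall>u\<in>L. \<forall>v\<in>L. orthogonal (x - (a + s)) (u - v))"
      using yL o xy by simp
  next
    fix y assume y: "y \<in> L \<and> (\<forall>u\<in>L. \<forall>v\<in>L. orthogonal (x - y) (u - v))"
    have "(x - y) \<bullet> (y - (a + s)) = 0" "(x - (a + s)) \<bullet> (y - (a + s)) = 0"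
      using y yL o[of y "a + s"] xy unfolding orthogonal_def by auto
    then have "(y - (a + s)) \<bullet> (y - (a + s)) = 0"
      by (simp add: inner_diff_left)
    then show "y = a + s" by simp
  qed
qed


section \<open>Planar fractal percolation\<close>

text \<open>
  The triple \<open>(n, i, j)\<close> with \<open>n \<ge> 1\<close> and \<open>i, j < M ^ n\<close> encodes the level-\<open>n\<close> closed square of
  side \<open>1 / M ^ n\<close> whose lower left corner is \<open>(i / M ^ n, j / M ^ n)\<close>.
\<close>

definition square :: "nat \<Rightarrow> nat \<Rightarrow> nat \<times> nat \<Rightarrow> (real^2) set" where
  "square M n = (\<lambda>(i, j).
     cbox (vector [real i / real M ^ n, real j / real M ^ n])
          (vector [(real i + 1) / real M ^ n, (real j + 1) / real M ^ n]))"

definition squares_idx :: "nat \<Rightarrow> (nat \<times> nat \<times> nat) set" where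
  "squares_idx M = {(n, i, j). 1 \<le> n \<and> i < M ^ n \<and> j < M ^ n}"

text \<open>
  \<open>R c\<close> is the event that the coin of the square \<open>c\<close> shows ``retain''. Coins are attached to all
  potential squares; those lying in a discarded square have no influence on the limit set.
\<close>

definition percolation_coins ::
    "nat \<Rightarrow> real \<Rightarrow> 'w measure \<Rightarrow> (nat \<times> nat \<times> nat \<Rightarrow> 'w set) \<Rightarrow> bool" where
  "percolation_coins M p P R \<longleftrightarrow>
     prob_space P \<and>
     prob_space.indep_events P R (squares_idx M) \<and>
     (\<forall>c \<in> squares_idx M. measure P (R c) = p)"

primrec retained ::
    "nat \<Rightarrow> (nat \<times> nat \<times> nat \<Rightarrow> 'w set) \<Rightarrow> 'w \<Rightarrow> nat \<Rightarrow> (nat \<times> nat) set" where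
  "retained M R \<omega> 0 = {(0, 0)}"
| "retained M R \<omega> (Suc n) =
     {(M * i + a, M * j + b) | i j a b.
        (i, j) \<in> retained M R \<omega> n \<and> a < M \<and> b < M \<and> \<omega> \<in> R (Suc n, M * i + a, M * j + b)}"

definition percolation_level ::
    "nat \<Rightarrow> (nat \<times> nat \<times> nat \<Rightarrow> 'w set) \<Rightarrow> 'w \<Rightarrow> nat \<Rightarrow> (real^2) set" where
  "percolation_level M R \<omega> n = (\<Union>c \<in> retained M R \<omega> n. square M n c)"

definition percolation_set ::
    "nat \<Rightarrow> (nat \<times> nat \<times> nat \<Rightarrow> 'w set) \<Rightarrow> 'w \<Rightarrow> (real^2) set" where
  "percolation_set M R \<omega> = (\<Inter>n\<in>{1..}. percolation_level M R \<omega> n)"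

end

theory Submission
  imports Defs "HOL-Real_Asymp.Real_Asymp"
begin

text \<open>
  Write \<open>\<lambda> = M\<^sup>2 p\<close> for the mean offspring number and \<open>Z\<^sub>n\<close> for the number of retained squares of level
  \<open>n\<close>. The first moment of \<open>Z\<^sub>n\<close> gives \<open>dim E \<le> max 0 (log\<^sub>M \<lambda>)\<close>, so only the lower bound for the projections
  in the case \<open>\<lambda> > 1\<close> is not routine.

  A strip of width \<open>M\<^sup>-\<^sup>m\<close> in any direction meets \<open>O(M\<^sup>m\<^sup>-\<^sup>l)\<close> squares of level \<open>m\<close> inside a given square of
  level \<open>l\<close>. Hence the number \<open>V\<close> of retained level-\<open>n\<close> squares below it has \<open>k\<close>-th moment at most
  \<open>k! (C m max(1, M p)\<^sup>m \<lambda>\<^sup>n\<^sup>-\<^sup>m)\<^sup>k\<close>. By Markov's inequality for large \<open>k\<close>, outside a small event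
  \<open>V \<le> \<lambda>\<^sup>n M\<^sup>-\<^sup>m\<^sup>t\<close> simultaneously for all strips of level \<open>m\<^sub>0 \<le> m \<le> n\<close>, uniformly in \<open>n\<close>, for any fixed
  \<open>t < min 1 (log\<^sub>M \<lambda>)\<close>. Second moments, together with the fact that small nonempty generations become
  unlikely, give \<open>Z\<^sub>n \<ge> c \<lambda>\<^sup>n\<close> on survival. So almost surely on survival both estimates hold
  for infinitely many \<open>n\<close>. If now intervals of lengths about \<open>M\<^sup>-\<^sup>m\<^sub>i\<close> cover a projection of \<open>E\<close>, then by
  compactness finitely many of the strips above them contain all retained squares of such a level \<open>n\<close>,
  whence \<open>c \<lambda>\<^sup>n \<le> Z\<^sub>n \<le> \<lambda>\<^sup>n \<Sum>\<^sub>i M\<^sup>-\<^sup>m\<^sub>i\<^sup>t\<close>: no limit measure is needed.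
\<close>

section \<open>Hausdorff dimension and projections to lines\<close>

lemma hausdorff_pre_measure_eq_0:
  assumes "hausdorff_measure s A = 0" "\<delta> > 0"
  shows "hausdorff_pre_measure \<delta> s A = 0"
proof -
  have "hausdorff_pre_measure \<delta> s A \<le> hausdorff_measure s A"
    unfolding hausdorff_measure_def using assms(2) by (intro SUP_upper) auto
  then show ?thesis using assms(1) by simp
qed

lemma null_hausdorff_measure_cover:
  fixes A :: "'a::metric_space set"
  assumes "hausdorff_measure s A = 0" "\<delta> > 0" "\<eta> > (0::ennreal)"
  obtains C :: "nat \<Rightarrow> 'a set" where "A \<subseteq> (\<Union>k. C k)"
    "\<And>k. bounded (C k)" "\<And>k. diameter (C k) \<le> \<delta>" "(\<Sum>k. diam_pow s (C k)) < \<eta>"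
proof -
  have "hausdorff_pre_measure \<delta> s A < \<eta>"
    using hausdorff_pre_measure_eq_0[OF assms(1,2)] assms(3) by simp
  then show ?thesis
    unfolding hausdorff_pre_measure_def INF_less_iff using that by auto
qed

text \<open>A finite cover whose members share the diameter bound \<open>d\<close> costs at most
  \<open>card \<D> * d powr s\<close>; padding with empty sets makes it a sequence. The clause
  \<open>d \<le> e\<close> makes the covers arbitrarily fine.\<close>

lemma null_hausdorff_measureI:
  fixes A :: "'a::metric_space set"
  assumes s: "s > 0"
    and cov: "\<And>e. e > 0 \<Longrightarrow> \<exists>\<D> d. finite \<D> \<and> A \<subseteq> \<Union>\<D> \<and> 0 \<le> d \<and> d \<le> e \<and>
        (\<forall>D\<in>\<D>. bounded D \<and> diameter D \<le> d) \<and> real (card \<D>) * d powr s \<le> e"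
  shows "hausdorff_measure s A = 0"
proof -
  have "hausdorff_pre_measure \<delta> s A \<le> 0" if \<delta>: "\<delta> > 0" for \<delta>
  proof (rule ennreal_le_epsilon)
    fix e :: real assume e: "e > 0"
    \<comment> \<open>Applied to \<open>min \<delta> e\<close>, the hypothesis gives one cover that
      is both \<open>\<delta>\<close>-fine and of cost at most \<open>e\<close>.\<close>
    obtain \<D> d where D: "finite \<D>" "A \<subseteq> \<Union>\<D>" "0 \<le> d" "d \<le> min \<delta> e"
      "\<forall>D\<in>\<D>. bounded D \<and> diameter D \<le> d" "real (card \<D>) * d powr s \<le> min \<delta> e"
      using cov[of "min \<delta> e"] e \<delta> by auto
    obtain f where f: "bij_betw f {..<card \<D>} \<D>"
      using ex_bij_betw_nat_finite[OF D(1)] by (auto simp: lessThan_atLeast0)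
    define C where "C k = (if k < card \<D> then f k else {})" for k
    have im: "f ` {..<card \<D>} = \<D>" using f by (rule bij_betw_imp_surj_on)
    have fk: "f k \<in> \<D>" if "k < card \<D>" for k
      using im that by blast
    have "\<Union>\<D> \<subseteq> (\<Union>k. C k)"
    proof
      fix x assume "x \<in> \<Union>\<D>"
      then obtain D where D': "D \<in> f ` {..<card \<D>}" "x \<in> D" unfolding im by auto
      then obtain k where "k < card \<D>" "f k = D" by blast
      then show "x \<in> (\<Union>k. C k)" using \<open>x \<in> D\<close> by (intro UN_I[of k]) (auto simp: C_def)
    qed
    then have cover: "A \<subseteq> (\<Union>k. C k)" using D(2) by auto
    have bd: "bounded (C k) \<and> diameter (C k) \<le> \<delta>" for k
      using D(4,5) fk[of k] \<delta> unfolding C_def by (auto intro: order_trans)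
    have dp: "diam_pow s (C k) \<le> (if k < card \<D> then ennreal (d powr s) else 0)" for k
    proof (cases "k < card \<D>")
      case True
      then have "bounded (f k)" "diameter (f k) \<le> d" using fk D(5) by auto
      then have "diameter (f k) powr s \<le> d powr s" using s diameter_ge_0 by (intro powr_mono2) auto
      then show ?thesis using True s by (simp add: C_def diam_pow_def ennreal_leI)
    qed (simp add: C_def diam_pow_def)
    have "hausdorff_pre_measure \<delta> s A \<le> (\<Sum>k. diam_pow s (C k))"
      unfolding hausdorff_pre_measure_def using cover bd by (intro INF_lower CollectI) blast
    also have "\<dots> \<le> (\<Sum>k. if k < card \<D> then ennreal (d powr s) else 0)"
      by (intro suminf_le dp) auto
    also have "\<dots> = (\<Sum>k<card \<D>. ennreal (d powr s))"
      by (subst suminf_finite[of "{..<card \<D>}"]) auto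
    also have "\<dots> = ennreal (real (card \<D>) * d powr s)"
      by (simp add: ennreal_mult'' ennreal_of_nat_eq_real_of_nat)
    also have "\<dots> \<le> ennreal e" using D(6) by (intro ennreal_leI) auto
    finally show "hausdorff_pre_measure \<delta> s A \<le> 0 + ennreal e" by simp
  qed
  then show ?thesis
    unfolding hausdorff_measure_def by (auto intro!: antisym SUP_least)
qed

lemma hausdorff_dim_leI:
  assumes "s \<ge> 0" "\<And>t. t > s \<Longrightarrow> hausdorff_measure t A = 0"
  shows "hausdorff_dim A \<le> ennreal s"
proof (rule ennreal_le_epsilon)
  fix e :: real assume "e > 0"
  then have "hausdorff_dim A \<le> ennreal (s + e)"
    unfolding hausdorff_dim_def using assms by (intro INF_lower) auto
  then show "hausdorff_dim A \<le> ennreal s + ennreal e"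
    using \<open>e > 0\<close> assms(1) by (simp add: ennreal_plus)
qed

lemma hausdorff_dim_geI:
  assumes "\<And>t. 0 \<le> t \<Longrightarrow> t < s \<Longrightarrow> hausdorff_measure t A \<noteq> 0"
  shows "ennreal s \<le> hausdorff_dim A"
  unfolding hausdorff_dim_def
proof (rule INF_greatest)
  fix t assume "t \<in> {t. 0 \<le> t \<and> hausdorff_measure t A = 0}"
  then show "ennreal s \<le> ennreal t" using assms[of t] by (intro ennreal_leI) force
qed

lemma diameter_image_le:
  fixes f :: "'a::metric_space \<Rightarrow> 'b::metric_space"
  assumes "\<And>x y. dist (f x) (f y) \<le> dist x y" "bounded C"
  shows "bounded (f ` C)" "diameter (f ` C) \<le> diameter C"
proof -
  obtain a e where a: "\<And>y. y \<in> C \<Longrightarrow> dist a y \<le> e"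
    using assms(2) unfolding bounded_def by blast
  then have "\<And>y. y \<in> C \<Longrightarrow> dist (f a) (f y) \<le> e" using assms(1) order_trans by blast
  then show "bounded (f ` C)" unfolding bounded_def by blast
  show "diameter (f ` C) \<le> diameter C"
  proof (cases "C = {}")
    case False
    then show ?thesis
      unfolding diameter_def[of "f ` C"]
      using order_trans[OF assms(1) diameter_bounded_bound[OF assms(2)]]
      by (auto intro!: cSUP_least)
  qed auto
qed

text \<open>The images of the members of a cover form a cover of the image with no larger diameters,
  so every exponent at which \<open>A\<close> is null is one at which its image is null.\<close>

lemma hausdorff_dim_image_le:
  fixes f :: "'a::metric_space \<Rightarrow> 'b::metric_space"
  assumes lip: "\<And>x y. dist (f x) (f y) \<le> dist x y"
  shows "hausdorff_dim (f ` A) \<le> hausdorff_dim A"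
proof -
  have pre: "hausdorff_pre_measure \<delta> s (f ` A) \<le> hausdorff_pre_measure \<delta> s A" if s: "s \<ge> 0" for \<delta> s
    unfolding hausdorff_pre_measure_def[of _ _ A]
  proof (rule INF_greatest)
    fix C :: "nat \<Rightarrow> 'a set"
    assume "C \<in> {C. A \<subseteq> (\<Union>k. C k) \<and> (\<forall>k. bounded (C k) \<and> diameter (C k) \<le> \<delta>)}"
    then have C: "A \<subseteq> (\<Union>k. C k)" "\<And>k. bounded (C k)" "\<And>k. diameter (C k) \<le> \<delta>" by auto
    have b: "bounded (f ` C k)" and d: "diameter (f ` C k) \<le> diameter (C k)" for k
      using diameter_image_le[OF lip C(2)] by blast+
    have d': "diameter (f ` C k) \<le> \<delta>" for k using d C(3) order_trans by blast
    have cover: "f ` A \<subseteq> (\<Union>k. f ` C k)" using C(1) by blast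
    have dp: "diam_pow s (f ` C k) \<le> diam_pow s (C k)" for k
      unfolding diam_pow_def using powr_mono2[OF s diameter_ge_0[OF b] d] by (simp add: ennreal_leI)
    have "hausdorff_pre_measure \<delta> s (f ` A) \<le> (\<Sum>k. diam_pow s (f ` C k))"
      unfolding hausdorff_pre_measure_def using cover b d' by (intro INF_lower CollectI) blast
    also have "\<dots> \<le> (\<Sum>k. diam_pow s (C k))"
      using dp by (intro suminf_le) auto
    finally show "hausdorff_pre_measure \<delta> s (f ` A) \<le> (\<Sum>k. diam_pow s (C k))" .
  qed
  have "hausdorff_measure s (f ` A) \<le> hausdorff_measure s A" if "s \<ge> 0" for s
    unfolding hausdorff_measure_def using pre[OF that] by (intro SUP_mono) blast
  then have "{s. 0 \<le> s \<and> hausdorff_measure s A = 0} \<subseteq> {s. 0 \<le> s \<and> hausdorff_measure s (f ` A) = 0}"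
    by (metis (mono_tags, lifting) Collect_mono le_zero_eq)
  then show ?thesis
    unfolding hausdorff_dim_def by (intro INF_superset_mono) auto
qed

section \<open>Coordinates on a line\<close>

text \<open>Reduces a line to a base point and a unit direction \<open>u\<close>. Two projections
  differ by \<open>((x - y) \<bullet> u) *\<^sub>R u\<close>, so later only
  \<open>\<bar>(x - y) \<bullet> u\<bar>\<close> matters.\<close>

lemma orth_proj_line:
  fixes L :: "'a::euclidean_space set"
  assumes "is_line L"
  obtains a u where "norm u = 1" "\<And>x. orth_proj L x = a + ((x - a) \<bullet> u) *\<^sub>R u"
proof -
  have aff: "affine L" and dim: "aff_dim L = 1" using assms by (auto simp: is_line_def)
  then obtain a where a: "a \<in> L" by force
  define S where "S = (\<lambda>x. x - a) ` L"
  have sub: "subspace S" using affine_diffs_subspace_subtract[OF aff a] by (simp add: S_def)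
  have dS: "dim S = 1"
    using dim a aff_dim_eq_dim_subtract[of a L] by (simp add: hull_inc S_def image_def Setcompr_eq_image)
  obtain B where B: "B \<subseteq> S" "pairwise orthogonal B" "\<And>x. x \<in> B \<Longrightarrow> norm x = 1"
    "card B = dim S" "span B = S"
    using orthonormal_basis_subspace[OF sub] by metis
  then obtain u where u: "B = {u}" using dS card_1_singletonE by metis
  have nu: "norm u = 1" using B u by auto
  have S: "S = range (\<lambda>k. k *\<^sub>R u)" using B(5) u by (simp add: span_singleton)
  have inL: "a + k *\<^sub>R u \<in> L" for k
  proof -
    have "k *\<^sub>R u \<in> S" using S by auto
    then show ?thesis by (auto simp: S_def)
  qed
  have diff: "\<exists>k. x - y = k *\<^sub>R u" if xy: "x \<in> L" "y \<in> L" for x y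
  proof -
    have "x - a \<in> S" "y - a \<in> S" using xy by (auto simp: S_def)
    then have "(x - a) - (y - a) \<in> S" using sub subspace_diff by blast
    then show ?thesis using S by auto
  qed
  have "orth_proj L x = a + ((x - a) \<bullet> u) *\<^sub>R u" for x
    unfolding orth_proj_def
  proof (rule the1_equality)
    show "\<exists>!y. y \<in> L \<and> (\<forall>u\<in>L. \<forall>v\<in>L. orthogonal (x - y) (u - v))"
      by (rule orth_proj_ex1) (use aff a in auto)
    have "(x - (a + ((x - a) \<bullet> u) *\<^sub>R u)) \<bullet> u = 0"
      using nu by (simp add: inner_simps norm_eq_1)
    then have "orthogonal (x - (a + ((x - a) \<bullet> u) *\<^sub>R u)) (w - v)" if "w \<in> L" "v \<in> L" for w v
      using diff[OF that] unfolding orthogonal_def by fastforce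
    then show "a + ((x - a) \<bullet> u) *\<^sub>R u \<in> L \<and>
      (\<forall>w\<in>L. \<forall>v\<in>L. orthogonal (x - (a + ((x - a) \<bullet> u) *\<^sub>R u)) (w - v))"
      using inL by blast
  qed
  with nu show ?thesis by (rule that)
qed

text \<open>Cutting the segment into \<open>n\<close> pieces of length of order \<open>1 / n\<close>
  costs \<open>n * (1 / n) powr t\<close> up to a constant, which vanishes in the limit for
  \<open>t > 1\<close>.\<close>

lemma hausdorff_dim_line_subset_le_1:
  fixes u :: "'a::euclidean_space"
  assumes u: "norm u = 1" and A: "A \<subseteq> (\<lambda>r. a + r *\<^sub>R u) ` {-b..b}"
  shows "hausdorff_dim A \<le> 1"
proof -
  have "hausdorff_measure t A = 0" if t: "t > 1" for t
  proof (rule null_hausdorff_measureI)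
    show "t > 0" using t by simp
    fix e :: real assume e: "e > 0"
    \<comment> \<open>The added 1 makes \<open>r + b' < 2 * b'\<close> strict, so that the right end
      of the segment still falls into a piece of index below \<open>n\<close>.\<close>
    define b' where "b' = \<bar>b\<bar> + 1"
    have b': "b' > 0" by (simp add: b'_def)
    have "(\<lambda>n. 2 * b' / real n) \<longlonglongrightarrow> 0" by real_asymp
    moreover have "(\<lambda>n. real n * (2 * b' / real n) powr t) \<longlonglongrightarrow> 0" using t b' by real_asymp
    ultimately have "\<forall>\<^sub>F n in sequentially. 2 * b' / real n < e \<and> real n * (2 * b' / real n) powr t < e \<and> n > 0"
      using e by (intro eventually_conj order_tendstoD eventually_gt_at_top) auto
    then obtain n :: nat where n: "2 * b' / real n < e" "real n * (2 * b' / real n) powr t < e" "n > 0"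
      using eventually_happens by fastforce
    define d where "d = 2 * b' / real n"
    define D where "D k = (\<lambda>r. a + r *\<^sub>R u) ` {- b' + d * real k .. - b' + d * (real k + 1)}" for k :: nat
    have d: "d > 0" using n b' by (simp add: d_def)
    have "A \<subseteq> \<Union>(D ` {..<n})"
    proof
      fix x assume "x \<in> A"
      then obtain r where r: "x = a + r *\<^sub>R u" "-b \<le> r" "r \<le> b"
        using A by (meson atLeastAtMost_iff image_iff subsetD)
      define k where "k = nat \<lfloor>(r + b') / d\<rfloor>"
      have pos: "0 \<le> (r + b') / d" using r d by (simp add: b'_def)
      then have "real k \<le> (r + b') / d" "(r + b') / d < real k + 1"
        unfolding k_def by linarith+
      then have k: "d * real k \<le> r + b'" "r + b' \<le> d * (real k + 1)"
        using d by (auto simp: field_simps)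
      have "r + b' < 2 * b'" using r by (simp add: b'_def)
      then have "d * real k < d * real n" using k n(3) by (simp add: d_def)
      then have "k < n" using d by simp
      moreover have "x \<in> D k" unfolding D_def r(1) using k by auto
      ultimately show "x \<in> \<Union>(D ` {..<n})" by blast
    qed
    moreover have "bounded (D k) \<and> diameter (D k) \<le> d" for k
    proof
      show "bounded (D k)" unfolding D_def
        by (intro compact_imp_bounded compact_continuous_image continuous_intros) auto
      have "norm (x - y) \<le> d" if xy: "x \<in> D k" "y \<in> D k" for x y
      proof -
        obtain r r' where r0: "x = a + r *\<^sub>R u" "y = a + r' *\<^sub>R u"
          "r \<in> {- b' + d * real k .. - b' + d * (real k + 1)}"
          "r' \<in> {- b' + d * real k .. - b' + d * (real k + 1)}"
          using xy unfolding D_def by blast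
        then have r: "x = a + r *\<^sub>R u" "y = a + r' *\<^sub>R u" "\<bar>r - r'\<bar> \<le> d"
          by (auto simp: algebra_simps abs_le_iff)
        have "x - y = (r - r') *\<^sub>R u" by (simp add: r algebra_simps)
        then show ?thesis using r(3) u by simp
      qed
      then show "diameter (D k) \<le> d" using d by (intro diameter_le) auto
    qed
    moreover have "real (card (D ` {..<n})) * d powr t \<le> e"
    proof -
      have "real (card (D ` {..<n})) \<le> real n" using card_image_le[of "{..<n}" D] by simp
      then have "real (card (D ` {..<n})) * d powr t \<le> real n * d powr t"
        by (intro mult_right_mono) auto
      then show ?thesis using n(2) by (simp add: d_def)
    qed
    ultimately show "\<exists>\<D> d. finite \<D> \<and> A \<subseteq> \<Union>\<D> \<and> 0 \<le> d \<and> d \<le> e \<and>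
        (\<forall>D\<in>\<D>. bounded D \<and> diameter D \<le> d) \<and> real (card \<D>) * d powr t \<le> e"
      using d n(1) by (intro exI[of _ "D ` {..<n}"] exI[of _ d]) (auto simp: d_def)
  qed
  then have "hausdorff_dim A \<le> ennreal 1" by (intro hausdorff_dim_leI) auto
  then show ?thesis by simp
qed

section \<open>Cells, ancestors and tubes\<close>

definition grid :: "nat \<Rightarrow> nat \<Rightarrow> (nat \<times> nat) set" where
  "grid M n = {..<M ^ n} \<times> {..<M ^ n}"

text \<open>Division by \<open>M ^ d\<close> drops the last \<open>d\<close> base-\<open>M\<close>
  digits of both coordinates, which leads \<open>d\<close> generations up. The level is not stored
  in the pair and is tracked separately.\<close>

definition anc :: "nat \<Rightarrow> nat \<Rightarrow> nat \<times> nat \<Rightarrow> nat \<times> nat" where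
  "anc M d q = (fst q div M ^ d, snd q div M ^ d)"

text \<open>The coins that decide the survival of \<open>q\<close>: its own and those of its
  ancestors. Level 0 has no coin, so there are exactly \<open>n\<close>.\<close>

definition path :: "nat \<Rightarrow> nat \<Rightarrow> nat \<times> nat \<Rightarrow> (nat \<times> nat \<times> nat) set" where
  "path M n q = (\<lambda>l. (l, anc M (n - l) q)) ` {1..n}"

lemma finite_grid [simp]: "finite (grid M n)"
  by (simp add: grid_def)

lemma card_grid: "card (grid M n) = M ^ (2 * n)"
  by (simp add: grid_def power2_eq_square flip: power_mult_distrib power_mult add: mult_2 power_add)

lemma anc_0 [simp]: "anc M 0 q = q"
  by (simp add: anc_def)

lemma anc_anc: "anc M d (anc M e q) = anc M (d + e) q"
  by (simp add: anc_def power_add mult.commute flip: div_mult2_eq)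

lemma anc_in_grid:
  assumes "q \<in> grid M n" "d \<le> n" "M > 0"
  shows "anc M d q \<in> grid M (n - d)"
proof -
  have "M ^ n = M ^ (n - d) * M ^ d" using assms(2) by (simp flip: power_add)
  then show ?thesis using assms by (auto simp: grid_def anc_def less_mult_imp_div_less)
qed

lemma anc_grid_top: "q \<in> grid M n \<Longrightarrow> anc M n q = (0, 0)"
  by (auto simp: grid_def anc_def)

lemma finite_path [simp]: "finite (path M n q)"
  by (simp add: path_def)

lemma card_path: "card (path M n q) = n"
  unfolding path_def by (subst card_image) (auto intro: inj_onI)

lemma path_0 [simp]: "path M 0 q = {}"
  by (simp add: path_def)

lemma path_Suc: "path M (Suc n) q = insert (Suc n, q) (path M n (anc M 1 q))"
proof -
  have "{1..Suc n} = insert (Suc n) {1..n}" by auto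
  then show ?thesis
    unfolding path_def by (simp add: anc_anc Suc_diff_le cong: image_cong_simp)
qed

lemma path_subset_idx:
  assumes "q \<in> grid M n" "M > 0"
  shows "path M n q \<subseteq> squares_idx M"
proof -
  have "(l, anc M (n - l) q) \<in> squares_idx M" if "l \<in> {1..n}" for l
    using anc_in_grid[OF assms(1), of "n - l"] assms(2) that
    by (auto simp: squares_idx_def grid_def mem_Times_iff)
  then show ?thesis by (auto simp: path_def)
qed

lemma path_level: "c \<in> path M n q \<Longrightarrow> fst c \<le> n \<and> fst c \<ge> 1"
  by (auto simp: path_def)

lemma retained_Suc_iff:
  assumes "M > 0"
  shows "q \<in> retained M R \<omega> (Suc n) \<longleftrightarrow> anc M 1 q \<in> retained M R \<omega> n \<and> \<omega> \<in> R (Suc n, q)"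
proof
  assume "q \<in> retained M R \<omega> (Suc n)"
  then show "anc M 1 q \<in> retained M R \<omega> n \<and> \<omega> \<in> R (Suc n, q)"
    by (auto simp: anc_def)
next
  assume *: "anc M 1 q \<in> retained M R \<omega> n \<and> \<omega> \<in> R (Suc n, q)"
  have "q = (M * (fst q div M) + fst q mod M, M * (snd q div M) + snd q mod M)" by simp
  moreover have "fst q mod M < M" "snd q mod M < M" using assms by auto
  moreover have "(fst q div M, snd q div M) \<in> retained M R \<omega> n" using * by (simp add: anc_def)
  ultimately show "q \<in> retained M R \<omega> (Suc n)" using * unfolding retained.simps by (smt (verit) mem_Collect_eq)
qed

lemma grid_Suc_iff:
  assumes "M > 0"
  shows "q \<in> grid M (Suc n) \<longleftrightarrow> anc M 1 q \<in> grid M n"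
  using assms by (cases q) (auto simp: grid_def anc_def div_less_iff_less_mult mult.commute)

text \<open>Unrolling the recursion turns survival into an intersection of coin events, so that its
  probability only depends on how many coins are involved.\<close>

lemma retained_iff:
  assumes "M > 0"
  shows "q \<in> retained M R \<omega> n \<longleftrightarrow> q \<in> grid M n \<and> (\<forall>c\<in>path M n q. \<omega> \<in> R c)"
proof (induction n arbitrary: q)
  case 0
  then show ?case by (cases q) (auto simp: grid_def)
next
  case (Suc n)
  then show ?case
    using assms by (auto simp: retained_Suc_iff path_Suc grid_Suc_iff simp del: retained.simps)
qed

lemma retained_subset_grid: "M > 0 \<Longrightarrow> retained M R \<omega> n \<subseteq> grid M n"
  by (auto simp: retained_iff)

lemma finite_retained [simp]: "M > 0 \<Longrightarrow> finite (retained M R \<omega> n)"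
  using finite_subset[OF retained_subset_grid finite_grid] .

lemma anc_retained:
  assumes "M > 0" "q \<in> retained M R \<omega> n" "d \<le> n"
  shows "anc M d q \<in> retained M R \<omega> (n - d)"
  using assms(3)
proof (induction d)
  case 0
  then show ?case using assms by simp
next
  case (Suc d)
  then have "anc M d q \<in> retained M R \<omega> (Suc (n - Suc d))"
    by (simp add: Suc_diff_Suc del: retained.simps)
  then have "anc M 1 (anc M d q) \<in> retained M R \<omega> (n - Suc d)"
    unfolding retained_Suc_iff[OF assms(1)] by (rule conjunct1)
  then show ?case by (simp add: anc_anc)
qed

lemma div_fibre:
  fixes D :: nat
  assumes "D > 0"
  shows "{i. i div D = k} = {k * D ..< (k + 1) * D}"
proof (intro set_eqI iffI)
  fix i assume "i \<in> {i. i div D = k}"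
  then show "i \<in> {k * D ..< (k + 1) * D}"
    using dividend_less_div_times[OF assms, of i] by (auto simp: div_times_less_eq_dividend)
next
  fix i assume "i \<in> {k * D ..< (k + 1) * D}"
  then show "i \<in> {i. i div D = k}" by (auto intro!: div_nat_eqI simp: mult.commute)
qed

lemma card_anc_fibre:
  assumes "M > 0"
  shows "finite {q. anc M d q = r}" "card {q. anc M d q = r} = M ^ (2 * d)"
proof -
  have "{q. anc M d q = r} = {fst r * M ^ d ..< (fst r + 1) * M ^ d} \<times> {snd r * M ^ d ..< (snd r + 1) * M ^ d}"
    unfolding div_fibre[of "M ^ d", symmetric, OF zero_less_power[OF assms]] by (cases r) (auto simp: anc_def)
  then show "finite {q. anc M d q = r}" "card {q. anc M d q = r} = M ^ (2 * d)"
    by (auto simp: mult_2 power_add)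
qed

section \<open>Tubes and counting in tubes\<close>

text \<open>
  A tube at level \<open>m\<close> is a discretised strip: its slope is rounded to a multiple of \<open>1 / M ^ m\<close>
  (\<open>a\<close> and \<open>b\<close> are the coefficients times \<open>M ^ m\<close>) and it is centred at a cell, so there are only
  polynomially many in \<open>M ^ m\<close>. The constant 5 absorbs all rounding errors, see \<open>lattice_tube_bound\<close>.
\<close>

definition tube :: "nat \<Rightarrow> nat \<Rightarrow> int \<times> int \<times> nat \<times> nat \<Rightarrow> (nat \<times> nat) set" where
  "tube M m = (\<lambda>(a, b, i0, j0).
     {(i, j) \<in> grid M m. \<bar>a * (int i - int i0) + b * (int j - int j0)\<bar> \<le> 5 * int M ^ m})"

text \<open>The normal direction is scaled so that its larger component becomes
  \<open>M ^ m\<close>. Fixing the other coordinate of a cell then leaves boundedly many values for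
  the corresponding one.\<close>

definition tube_params :: "nat \<Rightarrow> nat \<Rightarrow> (int \<times> int \<times> nat \<times> nat) set" where
  "tube_params M m = {(a, b, i0, j0). (i0, j0) \<in> grid M m \<and>
     (a = int M ^ m \<and> \<bar>b\<bar> \<le> int M ^ m \<or> \<bar>a\<bar> \<le> int M ^ m \<and> b = int M ^ m)}"

text \<open>Two elements differ by at most 10, because their linear values differ by at most
  \<open>10 * N\<close>; the least element anchors the set.\<close>

lemma card_nat_window:
  fixes N :: int
  assumes "N > 0"
  shows "finite {i :: nat. \<bar>N * (int i - i0) + x\<bar> \<le> 5 * N}"
    "card {i :: nat. \<bar>N * (int i - i0) + x\<bar> \<le> 5 * N} \<le> 11"
proof -
  define S where "S = {i :: nat. \<bar>N * (int i - i0) + x\<bar> \<le> 5 * N}"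
  have "finite S \<and> card S \<le> 11"
  proof (cases "S = {}")
    case False
    define i1 where "i1 = (LEAST i. i \<in> S)"
    have i1: "i1 \<in> S" "\<And>i. i \<in> S \<Longrightarrow> i1 \<le> i"
      using False LeastI_ex[of "\<lambda>i. i \<in> S"] Least_le[of "\<lambda>i. i \<in> S"] by (auto simp: i1_def)
    have "S \<subseteq> {i1..i1+10}"
    proof
      fix i assume i: "i \<in> S"
      have "N * (int i - int i1) = (N * (int i - i0) + x) - (N * (int i1 - i0) + x)"
        by (simp add: algebra_simps)
      also have "\<dots> \<le> N * 10" using i i1(1) by (auto simp: S_def abs_le_iff)
      finally have "int i - int i1 \<le> 10" using assms by simp
      then show "i \<in> {i1..i1+10}" using i1(2)[OF i] by auto
    qed
    then show ?thesis using finite_subset[of S] card_mono[of "{i1..i1+10}" S] by auto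
  qed auto
  then show "finite {i :: nat. \<bar>N * (int i - i0) + x\<bar> \<le> 5 * N}"
    "card {i :: nat. \<bar>N * (int i - i0) + x\<bar> \<le> 5 * N} \<le> 11" by (auto simp: S_def)
qed

text \<open>A tube is essentially one-dimensional: each row (if \<open>a = int M ^ m\<close>) or
  each column (if \<open>b = int M ^ m\<close>) meets it in a window of at most 11 cells, and only
  \<open>M ^ d\<close> rows or columns run through the descendants of \<open>r\<close>.\<close>

lemma card_tube_fibre:
  assumes "M > 0" "t \<in> tube_params M m"
  shows "card {q \<in> tube M m t. anc M d q = r} \<le> 11 * M ^ d"
proof -
  obtain a b i0 j0 where t: "t = (a, b, i0, j0)" by (cases t)
  have N: "int M ^ m > 0" using assms by simp
  define J where "J k = {k * M ^ d ..< (k + 1) * M ^ d}" for k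
  have cJ: "card (J k) = M ^ d" "finite (J k)" for k by (auto simp: J_def)
  have J: "i div M ^ d = k \<Longrightarrow> i \<in> J k" for i k
    using div_fibre[OF zero_less_power[OF assms(1)], of d k] unfolding J_def by blast
  consider "a = int M ^ m" | "b = int M ^ m" using assms(2) by (auto simp: tube_params_def t)
  then show ?thesis
  proof cases
    case 1
    define W where "W j = {i. \<bar>int M ^ m * (int i - int i0) + b * (int j - int j0)\<bar> \<le> 5 * int M ^ m}" for j :: nat
    have W: "finite (W j)" "card (W j) \<le> 11" for j
      unfolding W_def using card_nat_window[OF N] by auto
    have "{q \<in> tube M m t. anc M d q = r} \<subseteq> (\<Union>j\<in>J (snd r). (\<lambda>i. (i, j)) ` W j)"
    proof
      fix q assume "q \<in> {q \<in> tube M m t. anc M d q = r}"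
      then have q: "q \<in> tube M m t" "snd q div M ^ d = snd r" by (auto simp: anc_def)
      have "fst q \<in> W (snd q)" using q(1) by (auto simp: tube_def t 1 W_def add.commute)
      then show "q \<in> (\<Union>j\<in>J (snd r). (\<lambda>i. (i, j)) ` W j)"
        using J[OF q(2)] by (intro UN_I[of "snd q"] image_eqI[of _ _ "fst q"]) auto
    qed
    then have "card {q \<in> tube M m t. anc M d q = r} \<le> card (\<Union>j\<in>J (snd r). (\<lambda>i. (i, j)) ` W j)"
      using W cJ by (intro card_mono finite_UN_I finite_imageI) auto
    also have "\<dots> \<le> (\<Sum>j\<in>J (snd r). card ((\<lambda>i. (i, j)) ` W j))"
      using cJ by (intro card_UN_le) auto
    also have "\<dots> \<le> (\<Sum>j\<in>J (snd r). 11)"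
      using W card_image_le[of "W _"] order_trans by (intro sum_mono) blast
    finally show ?thesis using cJ by simp
  next
    case 2
    define W where "W i = {j. \<bar>int M ^ m * (int j - int j0) + a * (int i - int i0)\<bar> \<le> 5 * int M ^ m}" for i :: nat
    have W: "finite (W j)" "card (W j) \<le> 11" for j
      unfolding W_def using card_nat_window[OF N] by auto
    have "{q \<in> tube M m t. anc M d q = r} \<subseteq> (\<Union>i\<in>J (fst r). (\<lambda>j. (i, j)) ` W i)"
    proof
      fix q assume "q \<in> {q \<in> tube M m t. anc M d q = r}"
      then have q: "q \<in> tube M m t" "fst q div M ^ d = fst r" by (auto simp: anc_def)
      have "snd q \<in> W (fst q)" using q(1) by (auto simp: tube_def t 2 W_def add.commute)
      then show "q \<in> (\<Union>i\<in>J (fst r). (\<lambda>j. (i, j)) ` W i)"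
        using J[OF q(2)] by (intro UN_I[of "fst q"] image_eqI[of _ _ "snd q"]) auto
    qed
    then have "card {q \<in> tube M m t. anc M d q = r} \<le> card (\<Union>i\<in>J (fst r). (\<lambda>j. (i, j)) ` W i)"
      using W cJ by (intro card_mono finite_UN_I finite_imageI) auto
    also have "\<dots> \<le> (\<Sum>i\<in>J (fst r). card ((\<lambda>j. (i, j)) ` W i))"
      using cJ by (intro card_UN_le) auto
    also have "\<dots> \<le> (\<Sum>i\<in>J (fst r). 11)"
      using W card_image_le[of "W _"] order_trans by (intro sum_mono) blast
    finally show ?thesis using cJ by simp
  qed
qed

text \<open>One free coefficient and two centre coordinates give the exponent 3. This is the number
  that a union bound over all directions and positions at level \<open>m\<close> has to
  beat.\<close>

lemma finite_tube_params: "finite (tube_params M m)"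
  and card_tube_params_le: "M > 0 \<Longrightarrow> card (tube_params M m) \<le> 6 * M ^ (3 * m)"
proof -
  define N where "N = int M ^ m"
  define S where "S = ({N} \<times> {-N..N} \<times> grid M m) \<union> ({-N..N} \<times> {N} \<times> grid M m)"
  have sub: "tube_params M m \<subseteq> S"
    by (auto simp: tube_params_def S_def N_def abs_le_iff)
  have fin: "finite S" by (auto simp: S_def)
  show "finite (tube_params M m)" using sub fin finite_subset by blast
  assume M: "M > 0"
  have N: "N = int (M ^ m)" by (simp add: N_def)
  have cN: "card {-N..N} = 2 * M ^ m + 1" by (simp add: N nat_eq_iff)
  have "card S \<le> card ({N} \<times> {-N..N} \<times> grid M m) + card ({-N..N} \<times> {N} \<times> grid M m)"
    unfolding S_def by (rule card_Un_le)
  also have "\<dots> = 2 * ((2 * M ^ m + 1) * M ^ (2 * m))"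
    by (simp add: card_cartesian_product cN card_grid del: card_atLeastAtMost_int)
  also have "\<dots> \<le> 2 * ((3 * M ^ m) * M ^ (2 * m))"
    using M by (intro mult_left_mono mult_right_mono) auto
  also have "\<dots> = 6 * M ^ (m + 2 * m)" unfolding power_add by simp
  finally show "card (tube_params M m) \<le> 6 * M ^ (3 * m)"
    using card_mono[OF fin sub] by simp
qed

declare retained.simps(2) [simp del]

section \<open>First and second moments of the generation sizes\<close>

locale percolation = prob_space P
  for P :: "'w measure" +
  fixes M :: nat and p :: real and R :: "nat \<times> nat \<times> nat \<Rightarrow> 'w set"
  assumes M_ge_2: "M \<ge> 2" and p_pos: "0 < p" and p_le_1: "p \<le> 1"
    and indep_coins: "indep_events R (squares_idx M)"
    and prob_coin: "c \<in> squares_idx M \<Longrightarrow> prob (R c) = p"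
begin

abbreviation ret :: "nat \<Rightarrow> 'w \<Rightarrow> (nat \<times> nat) set" where
  "ret n \<omega> \<equiv> retained M R \<omega> n"

definition past :: "nat \<Rightarrow> 'w set set" where
  "past n = sigma_sets (space P) (R ` {c \<in> squares_idx M. fst c \<le> n})"

definition future :: "nat \<Rightarrow> 'w set set" where
  "future n = sigma_sets (space P) (R ` {c \<in> squares_idx M. fst c > n})"

lemma M_pos: "M > 0"
  using M_ge_2 by simp

lemma coin_event: "c \<in> squares_idx M \<Longrightarrow> R c \<in> events"
  using indep_coins unfolding indep_events_def by auto

lemma coin_subset_space: "c \<in> squares_idx M \<Longrightarrow> R c \<subseteq> space P"
  using coin_event sets.sets_into_space by blast

lemma past_subset_events: "past n \<subseteq> events"
  unfolding past_def using coin_event by (intro sets.sigma_sets_subset) auto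

text \<open>Grouping independent coins into two disjoint blocks keeps the generated sigma-algebras
  independent; a boolean indexes the two blocks.\<close>

lemma past_future_indep:
  assumes "A \<in> past n" "B \<in> future n"
  shows "prob (A \<inter> B) = prob A * prob B"
proof -
  define I where "I b = (if b then {c \<in> squares_idx M. fst c \<le> n} else {c \<in> squares_idx M. fst c > n})" for b
  have "indep_sets (\<lambda>b. sigma_sets (space P) (\<Union>i\<in>I b. {R i})) UNIV"
  proof (rule indep_sets_collect_sigma)
    have "(\<Union>b. I b) = squares_idx M" by (auto simp: I_def)
    then show "indep_sets (\<lambda>i. {R i}) (\<Union>b. I b)"
      using indep_coins by (simp add: indep_events_def_alt)
    show "Int_stable {R i}" for i by (auto simp: Int_stable_def)
    show "disjoint_family_on I UNIV" by (auto simp: disjoint_family_on_def I_def)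
  qed
  moreover have "(\<lambda>b. sigma_sets (space P) (\<Union>i\<in>I b. {R i})) = case_bool (past n) (future n)"
    by (auto simp: fun_eq_iff past_def future_def I_def UNION_singleton_eq_range split: bool.split)
  ultimately have "indep_set (past n) (future n)" by (simp add: indep_set_def)
  then show ?thesis using assms by (rule indep_setD)
qed

lemma prob_all_retained:
  assumes "U \<subseteq> squares_idx M" "finite U"
  shows "prob {\<omega> \<in> space P. \<forall>c\<in>U. \<omega> \<in> R c} = p ^ card U"
proof (cases "U = {}")
  case False
  then have "{\<omega> \<in> space P. \<forall>c\<in>U. \<omega> \<in> R c} = (\<Inter>c\<in>U. R c)"
    using coin_subset_space assms by blast
  moreover have "prob (\<Inter>c\<in>U. R c) = (\<Prod>c\<in>U. prob (R c))"
    using indep_coins assms False unfolding indep_events_def by blast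
  moreover have "(\<Prod>c\<in>U. prob (R c)) = (\<Prod>c\<in>U. p)"
    using prob_coin assms by (intro prod.cong) auto
  ultimately show ?thesis by simp
qed (simp add: prob_space)

text \<open>The complement of a coin event lies in the sigma-algebra generated by it, so
  independence carries over to discarding.\<close>

lemma prob_all_discarded:
  assumes "U \<subseteq> squares_idx M" "finite U"
  shows "prob {\<omega> \<in> space P. \<forall>c\<in>U. \<omega> \<notin> R c} = (1 - p) ^ card U"
proof (cases "U = {}")
  case False
  have "indep_sets (\<lambda>c. sigma_sets (space P) {R c}) (squares_idx M)"
    using indep_coins unfolding indep_events_def_alt
    by (intro indep_sets_sigma) (auto simp: Int_stable_def)
  then have "prob (\<Inter>c\<in>U. space P - R c) = (\<Prod>c\<in>U. prob (space P - R c))"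
    using assms False by (intro indep_setsD) (auto intro: sigma_sets.intros)
  moreover have "(\<Prod>c\<in>U. prob (space P - R c)) = (\<Prod>c\<in>U. 1 - p)"
    using prob_coin coin_event assms by (intro prod.cong) (auto simp: prob_compl)
  moreover have "{\<omega> \<in> space P. \<forall>c\<in>U. \<omega> \<notin> R c} = (\<Inter>c\<in>U. space P - R c)"
    using False by blast
  ultimately show ?thesis by simp
qed (simp add: prob_space)

lemma sigma_algebra_past: "sigma_algebra (space P) (past n)"
  and sigma_algebra_future: "sigma_algebra (space P) (future n)"
  unfolding past_def future_def using coin_subset_space
  by (intro sigma_algebra_sigma_sets; auto)+

lemma coin_past: "c \<in> squares_idx M \<Longrightarrow> fst c \<le> n \<Longrightarrow> R c \<in> past n"
  unfolding past_def by (intro sigma_sets.Basic) auto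

lemma coin_future: "c \<in> squares_idx M \<Longrightarrow> fst c > n \<Longrightarrow> R c \<in> future n"
  unfolding future_def by (intro sigma_sets.Basic) auto

text \<open>A generation takes finitely many values, each decided by finitely many coins. Hence an
  arbitrary predicate \<open>\<phi>\<close> of it defines an event, which settles all later
  measurability questions about single generations.\<close>

lemma ret_past:
  assumes "m \<le> n"
  shows "{\<omega> \<in> space P. \<phi> (ret m \<omega>)} \<in> past n"
proof -
  interpret S: sigma_algebra "space P" "past n" by (rule sigma_algebra_past)
  have 1: "{\<omega> \<in> space P. q \<in> ret m \<omega>} \<in> past n" if q: "q \<in> grid M m" for q
  proof -
    have "{\<omega> \<in> space P. \<forall>c\<in>path M m q. \<omega> \<in> R c} \<in> past n"
    proof (intro S.sets_Collect_finite_All)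
      fix c assume c: "c \<in> path M m q"
      then have "c \<in> squares_idx M" "fst c \<le> n"
        using path_subset_idx[OF q M_pos] path_level[OF c] assms by auto
      moreover from this have "{\<omega> \<in> space P. \<omega> \<in> R c} = R c" using coin_subset_space by blast
      ultimately show "{\<omega> \<in> space P. \<omega> \<in> R c} \<in> past n" using coin_past by simp
    qed simp
    then show ?thesis using q by (simp add: retained_iff[OF M_pos])
  qed
  have 2: "{\<omega> \<in> space P. ret m \<omega> = T} \<in> past n" if T: "T \<subseteq> grid M m" for T
  proof -
    have "{\<omega> \<in> space P. \<forall>q\<in>grid M m. q \<in> ret m \<omega> \<longleftrightarrow> q \<in> T} \<in> past n"
    proof (intro S.sets_Collect_finite_All)
      fix q assume "q \<in> grid M m"
      then show "{\<omega> \<in> space P. q \<in> ret m \<omega> \<longleftrightarrow> q \<in> T} \<in> past n"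
        using 1[of q] by (cases "q \<in> T") (auto intro: S.sets_Collect_neg)
    qed simp
    moreover have "(\<forall>q\<in>grid M m. q \<in> ret m \<omega> \<longleftrightarrow> q \<in> T) \<longleftrightarrow> ret m \<omega> = T" for \<omega>
      using T retained_subset_grid[OF M_pos, of R \<omega> m] by blast
    ultimately show ?thesis by simp
  qed
  have "{\<omega> \<in> space P. \<exists>T\<in>{T \<in> Pow (grid M m). \<phi> T}. ret m \<omega> = T} \<in> past n"
    by (intro S.sets_Collect_finite_Ex 2) auto
  moreover have "(\<exists>T\<in>{T \<in> Pow (grid M m). \<phi> T}. ret m \<omega> = T) \<longleftrightarrow> \<phi> (ret m \<omega>)" for \<omega>
    using retained_subset_grid[OF M_pos, of R \<omega> m] by blast
  ultimately show ?thesis by simp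
qed

lemma ret_event [measurable]: "{\<omega> \<in> space P. \<phi> (ret m \<omega>)} \<in> events"
  using ret_past[of m m] past_subset_events by blast

lemma ret_measurable [measurable]: "(\<lambda>\<omega>. f (ret n \<omega>) :: real) \<in> borel_measurable P"
proof (rule borel_measurableI)
  fix S :: "real set"
  show "(\<lambda>\<omega>. f (ret n \<omega>)) -` S \<inter> space P \<in> events"
    using ret_event[of "\<lambda>T. f T \<in> S" n] by (simp add: vimage_def Int_def conj_commute)
qed

lemma ret_integrable:
  assumes F: "F \<in> events"
  shows "integrable P (\<lambda>\<omega>. indicator F \<omega> * f (ret n \<omega>) :: real)"
proof (rule integrable_const_bound)
  define C where "C = Max ((\<lambda>T. \<bar>f T\<bar>) ` Pow (grid M n))"
  have "\<bar>f (ret n \<omega>)\<bar> \<le> C" for \<omega>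
    unfolding C_def using retained_subset_grid[OF M_pos, of R \<omega> n] by (intro Max_ge imageI) auto
  moreover have "\<bar>indicator F \<omega> * f (ret n \<omega>)\<bar> \<le> \<bar>f (ret n \<omega>)\<bar>" for \<omega>
    by (auto simp: indicator_def)
  ultimately show "AE \<omega> in P. norm (indicator F \<omega> * f (ret n \<omega>)) \<le> C"
    by (auto intro: order_trans)
qed (use F in measurable)

definition kept :: "nat \<Rightarrow> nat \<times> nat \<Rightarrow> 'w set" where
  "kept n q = {\<omega> \<in> space P. q \<in> ret n \<omega>}"

lemma kept_past: "kept n q \<in> past n"
  unfolding kept_def by (rule ret_past) simp

lemma kept_event [measurable]: "kept n q \<in> events"
  unfolding kept_def by measurable

lemma idx_Suc: "q \<in> grid M (Suc n) \<Longrightarrow> (Suc n, q) \<in> squares_idx M"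
  by (auto simp: grid_def squares_idx_def)

lemma kept_Suc:
  assumes "q \<in> grid M (Suc n)"
  shows "kept (Suc n) q = kept n (anc M 1 q) \<inter> R (Suc n, q)"
  using coin_subset_space[OF idx_Suc[OF assms]]
  unfolding kept_def retained_Suc_iff[OF M_pos] by blast

lemma card_ret_eq:
  assumes "\<omega> \<in> space P"
  shows "real (card (ret n \<omega>)) = (\<Sum>q\<in>grid M n. indicator (kept n q) \<omega>)"
proof -
  have "(\<Sum>q\<in>grid M n. indicator (kept n q) \<omega> :: real) = (\<Sum>q\<in>grid M n. if q \<in> ret n \<omega> then 1 else 0)"
    using assms by (intro sum.cong) (auto simp: kept_def)
  also have "\<dots> = real (card (grid M n \<inter> ret n \<omega>))"
    by (subst sum.inter_restrict[symmetric]) auto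
  also have "grid M n \<inter> ret n \<omega> = ret n \<omega>" using retained_subset_grid[OF M_pos, of R \<omega> n] by blast
  finally show ?thesis by simp
qed

definition lam :: real where
  "lam = real M ^ 2 * p"

lemma lam_pos: "lam > 0"
  using M_pos p_pos by (simp add: lam_def)

section \<open>Recursions for the moments\<close>

text \<open>Restricting to an event \<open>F\<close> of the past replaces conditioning: partitioning
  by the size of a generation then requires no conditional expectation.\<close>

definition first_moment :: "'w set \<Rightarrow> nat \<Rightarrow> real" where
  "first_moment F n = expectation (\<lambda>\<omega>. indicator F \<omega> * real (card (ret n \<omega>)))"

definition second_moment :: "'w set \<Rightarrow> nat \<Rightarrow> real" where
  "second_moment F n = expectation (\<lambda>\<omega>. indicator F \<omega> * real (card (ret n \<omega>)) ^ 2)"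

lemma first_moment_eq:
  assumes [measurable]: "F \<in> events"
  shows "first_moment F n = (\<Sum>q\<in>grid M n. prob (F \<inter> kept n q))"
proof -
  have "first_moment F n = expectation (\<lambda>\<omega>. \<Sum>q\<in>grid M n. indicator (F \<inter> kept n q) \<omega>)"
    unfolding first_moment_def
    by (intro Bochner_Integration.integral_cong) (auto simp: card_ret_eq sum_distrib_left indicator_inter_arith)
  also have "\<dots> = (\<Sum>q\<in>grid M n. prob (F \<inter> kept n q))"
    by (subst Bochner_Integration.integral_sum) (auto simp: less_top[symmetric])
  finally show ?thesis .
qed

lemma second_moment_eq:
  assumes [measurable]: "F \<in> events"
  shows "second_moment F n = (\<Sum>q\<in>grid M n. \<Sum>q'\<in>grid M n. prob (F \<inter> (kept n q \<inter> kept n q')))"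
proof -
  have "second_moment F n = expectation (\<lambda>\<omega>. \<Sum>q\<in>grid M n. \<Sum>q'\<in>grid M n. indicator (F \<inter> (kept n q \<inter> kept n q')) \<omega>)"
    unfolding second_moment_def
  proof (intro Bochner_Integration.integral_cong refl)
    fix \<omega> assume w: "\<omega> \<in> space P"
    have "real (card (ret n \<omega>)) ^ 2 =
        (\<Sum>q\<in>grid M n. \<Sum>q'\<in>grid M n. indicator (kept n q) \<omega> * indicator (kept n q') \<omega>)"
      unfolding power2_eq_square card_ret_eq[OF w] by (rule sum_product)
    then show "indicator F \<omega> * real (card (ret n \<omega>)) ^ 2 =
        (\<Sum>q\<in>grid M n. \<Sum>q'\<in>grid M n. indicator (F \<inter> (kept n q \<inter> kept n q')) \<omega>)"
      by (simp add: sum_distrib_left indicator_inter_arith del: sum_mult_indicator sum_indicator_mult)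
  qed
  also have "\<dots> = (\<Sum>q\<in>grid M n. \<Sum>q'\<in>grid M n. prob (F \<inter> (kept n q \<inter> kept n q')))"
    by (subst Bochner_Integration.integral_sum) (auto simp: less_top[symmetric])
  finally show ?thesis .
qed

lemma sum_anc:
  fixes f :: "nat \<times> nat \<Rightarrow> real"
  shows "(\<Sum>q\<in>grid M (Suc n). f (anc M 1 q)) = real M ^ 2 * (\<Sum>r\<in>grid M n. f r)"
proof -
  have "(\<Sum>q\<in>grid M (Suc n). f (anc M 1 q)) = (\<Sum>r\<in>grid M n. \<Sum>q\<in>{q \<in> grid M (Suc n). anc M 1 q = r}. f (anc M 1 q))"
    by (rule sum.group[symmetric]) (use grid_Suc_iff[OF M_pos] in auto)
  also have "\<dots> = (\<Sum>r\<in>grid M n. real M ^ 2 * f r)"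
  proof (intro sum.cong refl)
    fix r assume "r \<in> grid M n"
    then have *: "{q \<in> grid M (Suc n). anc M 1 q = r} = {q. anc M 1 q = r}"
      using grid_Suc_iff[OF M_pos] by blast
    show "(\<Sum>q\<in>{q \<in> grid M (Suc n). anc M 1 q = r}. f (anc M 1 q)) = real M ^ 2 * f r"
      unfolding * using card_anc_fibre(2)[OF M_pos, of 1 r] by (simp del: One_nat_def)
  qed
  finally show ?thesis by (simp add: sum_distrib_left)
qed

text \<open>The coin of a child is independent of \<open>F\<close> and of the survival of its
  parent, which gives the factor \<open>p\<close>; each parent has \<open>M ^ 2\<close>
  children.\<close>

lemma first_moment_Suc:
  assumes F: "F \<in> past n"
  shows "first_moment F (Suc n) = lam * first_moment F n"
proof -
  interpret S: sigma_algebra "space P" "past n" by (rule sigma_algebra_past)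
  have Fe: "F \<in> events" using F past_subset_events by blast
  have "first_moment F (Suc n) = (\<Sum>q\<in>grid M (Suc n). p * prob (F \<inter> kept n (anc M 1 q)))"
    unfolding first_moment_eq[OF Fe]
  proof (intro sum.cong refl)
    fix q assume q: "q \<in> grid M (Suc n)"
    have "prob ((F \<inter> kept n (anc M 1 q)) \<inter> R (Suc n, q)) = prob (F \<inter> kept n (anc M 1 q)) * prob (R (Suc n, q))"
      using F idx_Suc[OF q] by (intro past_future_indep[of _ n] coin_future S.Int kept_past) auto
    then show "prob (F \<inter> kept (Suc n) q) = p * prob (F \<inter> kept n (anc M 1 q))"
      using kept_Suc[OF q] prob_coin[OF idx_Suc[OF q]] by (simp add: Int_assoc mult.commute)
  qed
  also have "\<dots> = lam * first_moment F n"
    using sum_anc[of "\<lambda>r. p * prob (F \<inter> kept n r)" n]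
    by (simp add: first_moment_eq[OF Fe] lam_def sum_distrib_left[symmetric])
  finally show ?thesis .
qed

text \<open>Two distinct children, siblings or not, carry two independent new coins and contribute
  \<open>p ^ 2\<close>. On the diagonal there is a single coin, and the excess
  \<open>p - p ^ 2\<close> produces the first-moment term.\<close>

lemma second_moment_Suc:
  assumes F: "F \<in> past n"
  shows "second_moment F (Suc n) = lam ^ 2 * second_moment F n + lam * (1 - p) * first_moment F n"
proof -
  interpret S: sigma_algebra "space P" "past n" by (rule sigma_algebra_past)
  interpret S': sigma_algebra "space P" "future n" by (rule sigma_algebra_future)
  have Fe: "F \<in> events" using F past_subset_events by blast
  define g where "g r r' = prob (F \<inter> (kept n r \<inter> kept n r'))" for r r'
  have "prob (F \<inter> (kept (Suc n) q \<inter> kept (Suc n) q')) =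
      p ^ 2 * g (anc M 1 q) (anc M 1 q') + (if q = q' then (p - p ^ 2) * g (anc M 1 q) (anc M 1 q) else 0)"
    if q: "q \<in> grid M (Suc n)" "q' \<in> grid M (Suc n)" for q q'
  proof -
    define G where "G = F \<inter> (kept n (anc M 1 q) \<inter> kept n (anc M 1 q'))"
    define H where "H = R (Suc n, q) \<inter> R (Suc n, q')"
    have G: "G \<in> past n" unfolding G_def using F by (intro S.Int kept_past)
    have H: "H \<in> future n" unfolding H_def by (intro S'.Int coin_future idx_Suc q) auto
    have "F \<inter> (kept (Suc n) q \<inter> kept (Suc n) q') = G \<inter> H"
      using q by (auto simp: kept_Suc G_def H_def)
    then have 1: "prob (F \<inter> (kept (Suc n) q \<inter> kept (Suc n) q')) = prob G * prob H"
      using past_future_indep[OF G H] by simp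
    have "H = {\<omega> \<in> space P. \<forall>c\<in>{(Suc n, q), (Suc n, q')}. \<omega> \<in> R c}"
      using coin_subset_space[OF idx_Suc[OF q(1)]] unfolding H_def by blast
    then have "prob H = p ^ card {(Suc n, q), (Suc n, q')}"
      using prob_all_retained[of "{(Suc n, q), (Suc n, q')}"] idx_Suc q by simp
    then have 2: "prob H = (if q = q' then p else p ^ 2)" by (simp add: power2_eq_square)
    show ?thesis using 1 2 by (simp add: G_def g_def algebra_simps)
  qed
  then have "second_moment F (Suc n) = (\<Sum>q\<in>grid M (Suc n). \<Sum>q'\<in>grid M (Suc n).
      p ^ 2 * g (anc M 1 q) (anc M 1 q') + (if q = q' then (p - p ^ 2) * g (anc M 1 q) (anc M 1 q) else 0))"
    unfolding second_moment_eq[OF Fe] by (intro sum.cong refl) auto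
  also have "\<dots> = (\<Sum>q\<in>grid M (Suc n). \<Sum>q'\<in>grid M (Suc n). p ^ 2 * g (anc M 1 q) (anc M 1 q'))
      + (\<Sum>q\<in>grid M (Suc n). (p - p ^ 2) * g (anc M 1 q) (anc M 1 q))"
    by (simp add: sum.distrib sum.delta)
  also have "(\<Sum>q\<in>grid M (Suc n). \<Sum>q'\<in>grid M (Suc n). p ^ 2 * g (anc M 1 q) (anc M 1 q'))
      = lam ^ 2 * second_moment F n"
    unfolding second_moment_eq[OF Fe] g_def[symmetric]
    using sum_anc[of "\<lambda>r'. p ^ 2 * g _ r'"] sum_anc[of "\<lambda>r. (real M)^2 * (\<Sum>r'\<in>grid M n. p ^ 2 * g r r')" n]
    by (simp add: lam_def power_mult_distrib sum_distrib_left mult_ac power2_eq_square del: One_nat_def)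
  also have "(\<Sum>q\<in>grid M (Suc n). (p - p ^ 2) * g (anc M 1 q) (anc M 1 q)) = lam * (1 - p) * first_moment F n"
  proof -
    have "(\<Sum>q\<in>grid M (Suc n). (p - p ^ 2) * g (anc M 1 q) (anc M 1 q))
        = real M ^ 2 * (\<Sum>r\<in>grid M n. (p - p ^ 2) * g r r)"
      by (rule sum_anc)
    also have "\<dots> = real M ^ 2 * ((p - p ^ 2) * first_moment F n)"
      by (simp add: first_moment_eq[OF Fe] g_def sum_distrib_left)
    also have "\<dots> = lam * (1 - p) * first_moment F n"
      by (simp add: lam_def power2_eq_square algebra_simps)
    finally show ?thesis .
  qed
  finally show ?thesis .
qed

lemma first_moment_add:
  assumes F: "F \<in> past m"
  shows "first_moment F (m + d) = lam ^ d * first_moment F m"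
proof (induction d)
  case (Suc d)
  have "F \<in> past (m + d)"
    using F unfolding past_def by (rule rev_subsetD) (intro sigma_sets_mono', auto)
  then show ?case using first_moment_Suc Suc by simp
qed simp

text \<open>The quotient is the geometric sum of the diagonal terms of the \<open>d\<close>
  generations. Because of \<open>lam > 1\<close> it has order \<open>lam ^ d\<close>, so the added
  term stays comparable with \<open>lam ^ (2 * d)\<close>.\<close>

lemma second_moment_add:
  assumes F: "F \<in> past m" and lam: "lam > 1"
  shows "second_moment F (m + d) = lam ^ (2 * d) * second_moment F m + first_moment F m * (1 - p) * lam ^ d * ((lam ^ d - 1) / (lam - 1))"
proof (induction d)
  case (Suc d)
  have "F \<in> past (m + d)"
    using F unfolding past_def by (rule rev_subsetD) (intro sigma_sets_mono', auto)
  then have "second_moment F (m + Suc d) = lam ^ 2 * second_moment F (m + d) + lam * (1 - p) * (lam ^ d * first_moment F m)"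
    using second_moment_Suc first_moment_add[OF F] by simp
  also have "\<dots> = lam ^ (2 * Suc d) * second_moment F m +
      first_moment F m * (1 - p) * lam ^ Suc d * (lam * ((lam ^ d - 1) / (lam - 1)) + 1)"
  proof -
    have "lam ^ 2 * (lam ^ (2 * d) * a + x * (1 - p) * lam ^ d * c) + lam * (1 - p) * (lam ^ d * x) =
        lam ^ (2 * Suc d) * a + x * (1 - p) * lam ^ Suc d * (lam * c + 1)" for a x c
      by (simp add: power2_eq_square algebra_simps)
    then show ?thesis unfolding Suc .
  qed
  also have "lam * ((lam ^ d - 1) / (lam - 1)) + 1 = (lam ^ Suc d - 1) / (lam - 1)"
    using lam by (simp add: field_simps)
  finally show ?case by simp
qed simp

section \<open>Growth of surviving generations\<close>

text \<open>Chebyshev's inequality conditionally on the size \<open>z\<close> of generation \<open>m\<close>.\<close>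

lemma growth_given_card:
  assumes F: "F \<in> past m" and z: "\<And>\<omega>. \<omega> \<in> F \<Longrightarrow> card (ret m \<omega>) = z" "z > 0" and lam: "lam > 1"
  shows "prob (F \<inter> {\<omega> \<in> space P. real (card (ret (m + d) \<omega>)) < real z * lam ^ d / 2})
     \<le> 4 * (1 - p) / ((lam - 1) * real z) * prob F"
proof -
  have Fe [measurable]: "F \<in> events" using F past_subset_events by blast
  define L where "L = lam ^ d"
  have L: "L \<ge> 1" using lam by (simp add: L_def)
  define Z where "Z \<omega> = real (card (ret (m + d) \<omega>))" for \<omega>
  define G where "G = F \<inter> {\<omega> \<in> space P. Z \<omega> < real z * L / 2}"
  have G [measurable]: "G \<in> events"
    unfolding G_def Z_def using ret_event[of "\<lambda>T. real (card T) < real z * L / 2" "m + d"] by auto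
  have int: "integrable P (\<lambda>\<omega>. indicator F \<omega> * f (ret n \<omega>) :: real)" for f n
    by (rule ret_integrable[OF Fe])
  have "first_moment F m = expectation (\<lambda>\<omega>. real z * indicator F \<omega>)"
    unfolding first_moment_def by (intro Bochner_Integration.integral_cong) (auto simp: indicator_def z)
  then have m1: "first_moment F m = real z * prob F" by simp
  have "second_moment F m = expectation (\<lambda>\<omega>. real z ^ 2 * indicator F \<omega>)"
    unfolding second_moment_def by (intro Bochner_Integration.integral_cong) (auto simp: indicator_def z)
  then have m2: "second_moment F m = real z ^ 2 * prob F" by simp
  \<comment> \<open>The mean of \<open>Z\<close> given \<open>F\<close> is
    \<open>real z * L\<close>, and on \<open>G\<close> the deviation from it exceeds half of that
    mean.\<close>
  have "(real z * L / 2) ^ 2 * prob G = expectation (\<lambda>\<omega>. (real z * L / 2) ^ 2 * indicator G \<omega>)"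
    by simp
  also have "\<dots> \<le> expectation (\<lambda>\<omega>. indicator F \<omega> * (Z \<omega> - real z * L) ^ 2)"
  proof (rule integral_mono)
    show "integrable P (\<lambda>\<omega>. indicator F \<omega> * (Z \<omega> - real z * L) ^ 2)"
      unfolding Z_def by (rule int)
    fix \<omega>
    have "(real z * L / 2) ^ 2 \<le> (Z \<omega> - real z * L) ^ 2" if "\<omega> \<in> G"
    proof -
      have "(real z * L / 2) ^ 2 \<le> (real z * L - Z \<omega>) ^ 2"
        using that L by (intro power_mono) (auto simp: G_def algebra_simps)
      then show ?thesis by (simp add: power2_commute)
    qed
    then show "(real z * L / 2) ^ 2 * indicator G \<omega> \<le> indicator F \<omega> * (Z \<omega> - real z * L) ^ 2"
      by (auto simp: indicator_def G_def)
  qed (auto simp: less_top[symmetric])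
  also have "\<dots> = expectation (\<lambda>\<omega>. indicator F \<omega> * Z \<omega> ^ 2 - 2 * real z * L * (indicator F \<omega> * Z \<omega>)
      + (real z * L) ^ 2 * indicator F \<omega>)"
    by (intro Bochner_Integration.integral_cong) (auto simp: power2_eq_square algebra_simps)
  also have "\<dots> = second_moment F (m + d) - 2 * real z * L * first_moment F (m + d) + (real z * L) ^ 2 * prob F"
    using int[of "\<lambda>T. real (card T)" "m + d"] int[of "\<lambda>T. real (card T) ^ 2" "m + d"]
    unfolding first_moment_def second_moment_def Z_def by (simp add: less_top[symmetric])
  \<comment> \<open>The terms quadratic in \<open>z\<close> cancel since the restricted mean is
    exact; only the variance remains.\<close>
  also have "\<dots> = real z * prob F * (1 - p) * L * ((L - 1) / (lam - 1))"
  proof -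
    have L2: "lam ^ (2 * d) = L ^ 2" by (simp add: L_def power_mult mult.commute flip: power_mult)
    have "L ^ 2 * (y ^ 2 * a) + y * a * (1 - p) * L * c - 2 * y * L * (L * (y * a)) + (y * L) ^ 2 * a
        = y * a * (1 - p) * L * c" for y a c
      by (simp add: power2_eq_square algebra_simps)
    then show ?thesis
      unfolding first_moment_add[OF F] second_moment_add[OF F lam] m1 m2 L2 L_def[symmetric] .
  qed
  also have "\<dots> \<le> real z * prob F * (1 - p) * L * (L / (lam - 1))"
    using L p_le_1 lam by (intro mult_left_mono divide_right_mono mult_nonneg_nonneg) auto
  finally have "(real z * L / 2) ^ 2 * prob G \<le> real z * prob F * (1 - p) * L * (L / (lam - 1))" .
  moreover have "(real z * L / 2) ^ 2 * prob G = prob G * (real z * L) ^ 2 / 4"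
    by (simp add: power_divide)
  ultimately have "prob G * (real z * L) ^ 2 \<le> 4 * (real z * prob F * (1 - p) * L * (L / (lam - 1)))"
    by linarith
  moreover have "(real z * L) ^ 2 > 0" using z(2) L by simp
  ultimately have "prob G \<le> 4 * (real z * prob F * (1 - p) * L * (L / (lam - 1))) / (real z * L) ^ 2"
    using pos_le_divide_eq by blast
  also have "\<dots> = 4 * (1 - p) / ((lam - 1) * real z) * prob F"
    using z(2) L lam by (simp add: field_simps power2_eq_square)
  finally show ?thesis by (simp add: G_def Z_def L_def)
qed

text \<open>Sums the previous estimate over the disjoint events of exact size
  \<open>z \<ge> k\<close>. Its factor decreases in \<open>z\<close>, so the one for
  \<open>k\<close> serves for all of them.\<close>

lemma growth_after_large_generation:
  assumes k: "k > 0" and lam: "lam > 1"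
  shows "prob {\<omega> \<in> space P. card (ret m \<omega>) \<ge> k \<and> real (card (ret (m + d) \<omega>)) < lam ^ d / 2}
     \<le> 4 * (1 - p) / ((lam - 1) * real k)"
proof -
  define F where "F z = {\<omega> \<in> space P. card (ret m \<omega>) = z}" for z
  define A where "A = {\<omega> \<in> space P. real (card (ret (m + d) \<omega>)) < lam ^ d / 2}"
  define Q where "Q = {k..M ^ (2 * m)}"
  have A [measurable]: "A \<in> events" unfolding A_def by (rule ret_event)
  have F: "F z \<in> past m" "F z \<in> events" for z
    unfolding F_def using ret_past[of m m] ret_event by auto
  have le: "card (ret m \<omega>) \<le> M ^ (2 * m)" for \<omega>
    using card_mono[OF finite_grid retained_subset_grid[OF M_pos, of R \<omega> m]] by (simp add: card_grid)
  have "{\<omega> \<in> space P. card (ret m \<omega>) \<ge> k \<and> real (card (ret (m + d) \<omega>)) < lam ^ d / 2} \<subseteq> (\<Union>z\<in>Q. F z \<inter> A)"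
    using le by (auto simp: F_def A_def Q_def)
  then have "prob {\<omega> \<in> space P. card (ret m \<omega>) \<ge> k \<and> real (card (ret (m + d) \<omega>)) < lam ^ d / 2}
      \<le> prob (\<Union>z\<in>Q. F z \<inter> A)"
    using F by (intro finite_measure_mono) (auto simp: Q_def)
  also have "\<dots> \<le> (\<Sum>z\<in>Q. prob (F z \<inter> A))"
    using F by (intro finite_measure_subadditive_finite) (auto simp: Q_def)
  also have "\<dots> \<le> (\<Sum>z\<in>Q. 4 * (1 - p) / ((lam - 1) * real k) * prob (F z))"
  proof (intro sum_mono)
    fix z assume z: "z \<in> Q"
    then have z0: "z > 0" "z \<ge> k" using k by (auto simp: Q_def)
    have "lam ^ d / 2 \<le> real z * lam ^ d / 2" using z0 lam by simp
    then have "prob (F z \<inter> A) \<le> prob (F z \<inter> {\<omega> \<in> space P. real (card (ret (m + d) \<omega>)) < real z * lam ^ d / 2})"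
      using F ret_event[of "\<lambda>T. real (card T) < real z * lam ^ d / 2"] \<open>lam ^ d / 2 \<le> real z * lam ^ d / 2\<close>
      by (intro finite_measure_mono) (auto simp: A_def intro: less_le_trans)
    also have "\<dots> \<le> 4 * (1 - p) / ((lam - 1) * real z) * prob (F z)"
      using F z0 lam by (intro growth_given_card) (auto simp: F_def)
    also have "\<dots> \<le> 4 * (1 - p) / ((lam - 1) * real k) * prob (F z)"
      using z0 k lam p_le_1 by (intro mult_right_mono divide_left_mono mult_left_mono) auto
    finally show "prob (F z \<inter> A) \<le> 4 * (1 - p) / ((lam - 1) * real k) * prob (F z)" .
  qed
  also have "\<dots> = 4 * (1 - p) / ((lam - 1) * real k) * prob (\<Union>z\<in>Q. F z)"
    using F by (subst finite_measure_finite_Union)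
      (auto simp: Q_def disjoint_family_on_def F_def sum_distrib_left)
  also have "\<dots> \<le> 4 * (1 - p) / ((lam - 1) * real k) * 1"
    using lam p_le_1 by (intro mult_left_mono) auto
  finally show ?thesis by simp
qed

text \<open>A small generation dies out at once with probability bounded below, and the generations
  at which this happens are distinct, so small nonempty generations become improbable.\<close>

lemma small_generation_tendsto_0:
  assumes "p < 1"
  shows "(\<lambda>m. prob {\<omega> \<in> space P. 1 \<le> card (ret m \<omega>) \<and> card (ret m \<omega>) < k}) \<longlonglongrightarrow> 0"
proof -
  define F where "F m = {\<omega> \<in> space P. 1 \<le> card (ret m \<omega>) \<and> card (ret m \<omega>) < k}" for m
  define X where "X m = F m \<inter> {\<omega> \<in> space P. ret (Suc m) \<omega> = {}}" for m
  \<comment> \<open>On \<open>F m\<close> there are fewer than \<open>k\<close> cells and hence at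
    most \<open>M ^ 2 * k\<close> child coins; \<open>e\<close> bounds from below the chance that
    all of them show discard.\<close>
  define e where "e = (1 - p) ^ (M ^ 2 * k)"
  have e: "e > 0" using assms by (simp add: e_def)
  have Fe [measurable]: "F m \<in> events" for m unfolding F_def by (rule ret_event)
  have Xe [measurable]: "X m \<in> events" for m unfolding X_def by (intro sets.Int Fe ret_event)
  have "disjoint_family X"
    unfolding disjoint_family_on_def
  proof (intro ballI impI)
    have lt: "X m \<inter> X n = {}" if "m < n" for m n
    proof -
      have "ret n \<omega> = {}" if e: "ret (Suc m) \<omega> = {}" for \<omega>
      proof (rule ccontr)
        assume "ret n \<omega> \<noteq> {}"
        then obtain q where "q \<in> ret n \<omega>" by blast
        then have "anc M (n - Suc m) q \<in> ret (n - (n - Suc m)) \<omega>"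
          using M_pos by (intro anc_retained) auto
        then show False using e \<open>m < n\<close> by simp
      qed
      then show ?thesis unfolding X_def F_def by force
    qed
    fix m n :: nat assume "m \<noteq> n"
    then show "X m \<inter> X n = {}"
      using lt[of m n] lt[of n m] by (auto simp: neq_iff)
  qed
  then have "(\<lambda>m. prob (X m)) sums prob (\<Union>m. X m)"
    by (intro finite_measure_UNION) auto
  then have "(\<lambda>m. prob (X m)) \<longlonglongrightarrow> 0" by (intro summable_LIMSEQ_zero) (simp add: sums_iff)
  then have lim: "(\<lambda>m. prob (X m) / e) \<longlonglongrightarrow> 0" using tendsto_divide_zero by blast
  have "prob (F m) * e \<le> prob (X m)" for m
  proof -
    \<comment> \<open>Fixing the value \<open>T\<close> of generation \<open>m\<close> makes the set
      of child coins deterministic, so the independence of past and future applies to each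
      piece.\<close>
    define TT where "TT = {T \<in> Pow (grid M m). 1 \<le> card T \<and> card T < k}"
    have finT: "finite TT" by (auto simp: TT_def)
    define D where "D T = {\<omega> \<in> space P. ret m \<omega> = T}" for T
    define U where "U T = Pair (Suc m) ` {q \<in> grid M (Suc m). anc M 1 q \<in> T}" for T
    define E where "E T = {\<omega> \<in> space P. \<forall>c\<in>U T. \<omega> \<notin> R c}" for T
    have DP: "D T \<in> past m" for T unfolding D_def by (rule ret_past) simp
    have De [measurable]: "D T \<in> events" for T using DP past_subset_events by blast
    have Uidx: "U T \<subseteq> squares_idx M" "finite (U T)" for T
      using idx_Suc by (auto simp: U_def)
    have EF: "E T \<in> future m" for T
    proof -
      interpret S: sigma_algebra "space P" "future m" by (rule sigma_algebra_future)
      show ?thesis unfolding E_def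
      proof (intro S.sets_Collect_finite_All S.sets_Collect_neg Uidx)
        fix c assume c: "c \<in> U T"
        then have "{\<omega> \<in> space P. \<omega> \<in> R c} = R c" using Uidx coin_subset_space by blast
        then show "{\<omega> \<in> space P. \<omega> \<in> R c} \<in> future m"
          using c Uidx by (auto simp: U_def intro!: coin_future)
      qed
    qed
    have Ee [measurable]: "E T \<in> events" for T
    proof -
      have "future m \<subseteq> events"
        unfolding future_def using coin_event by (intro sets.sigma_sets_subset) auto
      then show ?thesis using EF by blast
    qed
    have F: "F m = (\<Union>T\<in>TT. D T)"
      using retained_subset_grid[OF M_pos, of R _ m] by (auto simp: F_def TT_def D_def)
    have "D T \<inter> E T \<subseteq> X m" if "T \<in> TT" for T
    proof
      fix \<omega> assume w: "\<omega> \<in> D T \<inter> E T"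
      then have "ret (Suc m) \<omega> = {}"
        unfolding D_def E_def U_def
        using retained_Suc_iff[OF M_pos, of _ R \<omega> m] retained_subset_grid[OF M_pos, of R \<omega> "Suc m"]
        by (auto) blast
      then show "\<omega> \<in> X m" using w that by (auto simp: X_def F_def TT_def D_def)
    qed
    then have sub: "(\<Union>T\<in>TT. D T \<inter> E T) \<subseteq> X m" by blast
    have "prob (F m) * e = (\<Sum>T\<in>TT. prob (D T) * e)"
      unfolding F by (subst finite_measure_finite_Union)
        (auto simp: finT disjoint_family_on_def D_def sum_distrib_right)
    also have "\<dots> \<le> (\<Sum>T\<in>TT. prob (D T \<inter> E T))"
    proof (intro sum_mono)
      fix T assume T: "T \<in> TT"
      have "card (U T) = card {q \<in> grid M (Suc m). anc M 1 q \<in> T}"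
        unfolding U_def by (intro card_image) (auto intro: inj_onI)
      also have "\<dots> \<le> card (\<Union>r\<in>T. {q. anc M 1 q = r})"
        using T card_anc_fibre[OF M_pos] by (intro card_mono) (auto simp: TT_def finite_subset[of _ "grid M m"] simp del: One_nat_def)
      also have "\<dots> \<le> (\<Sum>r\<in>T. card {q. anc M 1 q = r})"
        using T by (intro card_UN_le) (auto simp: TT_def intro: finite_subset[of _ "grid M m"])
      also have "\<dots> = card T * M ^ 2" by (simp add: card_anc_fibre[OF M_pos] del: One_nat_def)
      also have "\<dots> \<le> M ^ 2 * k" using T by (simp add: TT_def)
      finally have "e \<le> (1 - p) ^ card (U T)"
        unfolding e_def using p_pos assms by (intro power_decreasing) auto
      also have "\<dots> = prob (E T)" unfolding E_def using prob_all_discarded[OF Uidx] by simp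
      finally show "prob (D T) * e \<le> prob (D T \<inter> E T)"
        unfolding past_future_indep[OF DP EF] by (intro mult_left_mono) auto
    qed
    also have "\<dots> = prob (\<Union>T\<in>TT. D T \<inter> E T)"
      by (rule finite_measure_finite_Union[symmetric])
        (auto simp: finT disjoint_family_on_def D_def)
    also have "\<dots> \<le> prob (X m)" using sub by (intro finite_measure_mono) auto
    finally show ?thesis .
  qed
  then have "prob (F m) \<le> prob (X m) / e" for m using e by (simp add: pos_le_divide_eq)
  then have "(\<lambda>m. prob (F m)) \<longlonglongrightarrow> 0"
    using lim by (intro tendsto_sandwich[OF _ _ tendsto_const lim]) auto
  then show ?thesis by (simp add: F_def)
qed

end

section \<open>Moments of the number of retained cells in a tube\<close>

context percolation
begin

text \<open>A union in which coins shared by several cells count once; this sharing is the only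
  source of correlation between cells.\<close>

definition pathset :: "nat \<Rightarrow> (nat \<times> nat) set \<Rightarrow> (nat \<times> nat \<times> nat) set" where
  "pathset n T = (\<Union>q\<in>T. path M n q)"

lemma prob_all_kept:
  assumes "T \<subseteq> grid M n"
  shows "prob {\<omega> \<in> space P. T \<subseteq> ret n \<omega>} = p ^ card (pathset n T)"
proof -
  have fin: "finite T" using assms by (auto intro: finite_subset[OF _ finite_grid])
  have "T \<subseteq> ret n \<omega> \<longleftrightarrow> (\<forall>c\<in>pathset n T. \<omega> \<in> R c)" for \<omega>
    using assms unfolding subset_iff retained_iff[OF M_pos] pathset_def by blast
  moreover have "pathset n T \<subseteq> squares_idx M"
    unfolding pathset_def by (intro UN_least path_subset_idx M_pos) (use assms in auto)
  moreover have "finite (pathset n T)" unfolding pathset_def using fin by simp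
  ultimately show ?thesis using prob_all_retained[of "pathset n T"] by simp
qed

text \<open>Let \<open>l\<close> be the deepest level at which \<open>q\<close> shares an ancestor
  with a cell of \<open>T\<close>. The \<open>n - l\<close> coins of \<open>q\<close> below it are
  new. Replacing the best partner and level by the sum over all candidates gives a bound that is
  easily summed over \<open>q\<close>.\<close>

lemma new_path_le:
  assumes "T \<subseteq> grid M n" "T \<noteq> {}" "q \<in> grid M n"
  shows "p ^ card (path M n q - pathset n T)
    \<le> (\<Sum>q'\<in>T. \<Sum>l\<le>n. if anc M (n - l) q = anc M (n - l) q' then p ^ (n - l) else 0)"
proof -
  have fin: "finite T" using assms by (auto intro: finite_subset[OF _ finite_grid])
  define S where "S = {l. l \<le> n \<and> (\<exists>q'\<in>T. anc M (n - l) q = anc M (n - l) q')}"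
  \<comment> \<open>All cells share the root, so level 0 always qualifies and the maximum
    exists.\<close>
  obtain q0 where "q0 \<in> T" using assms(2) by blast
  then have "anc M (n - 0) q = anc M (n - 0) q0"
    using assms anc_grid_top[of q M n] anc_grid_top[of q0 M n] by auto
  with \<open>q0 \<in> T\<close> have "0 \<in> S" unfolding S_def by blast
  have finS: "finite S" by (auto simp: S_def)
  define l where "l = Max S"
  have "l \<in> S" unfolding l_def using finS \<open>0 \<in> S\<close> by (intro Max_in) auto
  then obtain q' where q': "q' \<in> T" "anc M (n - l) q = anc M (n - l) q'" and ln: "l \<le> n"
    by (auto simp: S_def)
  have "(\<lambda>l'. (l', anc M (n - l') q)) ` {l<..n} \<subseteq> path M n q - pathset n T"
  proof
    fix c assume "c \<in> (\<lambda>l'. (l', anc M (n - l') q)) ` {l<..n}"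
    then obtain l' where l': "c = (l', anc M (n - l') q)" "l < l'" "l' \<le> n" by auto
    have "c \<notin> pathset n T"
    proof
      assume "c \<in> pathset n T"
      then have "l' \<in> S" using l' by (auto simp: pathset_def path_def S_def)
      from Max_ge[OF finS this] show False using l'(2) by (simp add: l_def)
    qed
    then show "c \<in> path M n q - pathset n T" using l' by (auto simp: path_def)
  qed
  then have "card ((\<lambda>l'. (l', anc M (n - l') q)) ` {l<..n}) \<le> card (path M n q - pathset n T)"
    by (intro card_mono) auto
  moreover have "card ((\<lambda>l'. (l', anc M (n - l') q)) ` {l<..n}) = n - l"
    by (subst card_image) (auto intro: inj_onI)
  ultimately have "p ^ card (path M n q - pathset n T) \<le> p ^ (n - l)"
    using p_pos p_le_1 by (intro power_decreasing) auto
  also have "\<dots> = (\<Sum>l\<in>{l}. if anc M (n - l) q = anc M (n - l) q' then p ^ (n - l) else 0)"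
    using q' by simp
  also have "\<dots> \<le> (\<Sum>l\<le>n. if anc M (n - l) q = anc M (n - l) q' then p ^ (n - l) else 0)"
    using p_pos ln by (intro sum_mono2) auto
  also have "\<dots> = (\<Sum>q'\<in>{q'}. \<Sum>l\<le>n. if anc M (n - l) q = anc M (n - l) q' then p ^ (n - l) else 0)"
    by simp
  also have "\<dots> \<le> (\<Sum>q'\<in>T. \<Sum>l\<le>n. if anc M (n - l) q = anc M (n - l) q' then p ^ (n - l) else 0)"
    using p_pos q' fin by (intro sum_mono2) (auto intro!: sum_nonneg)
  finally show ?thesis .
qed

text \<open>The hypothesis weighs the cells of \<open>H\<close> by their kinship with one cell
  \<open>r\<close>, so \<open>B\<close> bounds the mean number of retained cells of \<open>H\<close>
  given that \<open>r\<close> is retained. Passing from one cell to all of \<open>T\<close> costs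
  the factor \<open>card T\<close>.\<close>

lemma sum_new_path_le:
  assumes T: "T \<subseteq> grid M n" "T \<noteq> {}" and H: "H \<subseteq> grid M n"
    and B: "\<And>r. r \<in> grid M n \<Longrightarrow>
      (\<Sum>l\<le>n. real (card {q \<in> H. anc M (n - l) q = anc M (n - l) r}) * p ^ (n - l)) \<le> B"
  shows "(\<Sum>q\<in>H. p ^ card (pathset n (insert q T))) \<le> p ^ card (pathset n T) * (real (card T) * B)"
proof -
  have finT: "finite T" and finH: "finite H" using finite_subset[OF T(1)] finite_subset[OF H] by auto
  have "p ^ card (pathset n (insert q T)) = p ^ card (pathset n T) * p ^ card (path M n q - pathset n T)" for q
  proof -
    have "pathset n (insert q T) = pathset n T \<union> (path M n q - pathset n T)"
      by (auto simp: pathset_def)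
    moreover have "card (pathset n T \<union> (path M n q - pathset n T))
        = card (pathset n T) + card (path M n q - pathset n T)"
      using finT by (intro card_Un_disjoint) (auto simp: pathset_def)
    ultimately show ?thesis by (simp add: power_add)
  qed
  then have "(\<Sum>q\<in>H. p ^ card (pathset n (insert q T)))
      = p ^ card (pathset n T) * (\<Sum>q\<in>H. p ^ card (path M n q - pathset n T))"
    by (simp add: sum_distrib_left)
  also have "(\<Sum>q\<in>H. p ^ card (path M n q - pathset n T))
      \<le> (\<Sum>q\<in>H. \<Sum>r\<in>T. \<Sum>l\<le>n. if anc M (n - l) q = anc M (n - l) r then p ^ (n - l) else 0)"
    using T H by (intro sum_mono new_path_le) auto
  also have "\<dots> = (\<Sum>r\<in>T. \<Sum>l\<le>n. \<Sum>q\<in>H. if anc M (n - l) q = anc M (n - l) r then p ^ (n - l) else 0)"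
    by (subst sum.swap) (intro sum.cong refl sum.swap)
  also have "\<dots> = (\<Sum>r\<in>T. \<Sum>l\<le>n. real (card {q \<in> H. anc M (n - l) q = anc M (n - l) r}) * p ^ (n - l))"
    using finH by (intro sum.cong refl) (simp add: sum.If_cases Int_def)
  also have "\<dots> \<le> (\<Sum>r\<in>T. B)" using T by (intro sum_mono B) auto
  also have "\<dots> = real (card T) * B" by simp
  finally show ?thesis using p_pos by (simp add: mult_left_mono)
qed

lemma ret_integrable': "integrable P (\<lambda>\<omega>. f (ret n \<omega>) :: real)"
proof -
  have "integrable P (\<lambda>\<omega>. indicator (space P) \<omega> * f (ret n \<omega>))"
    by (rule ret_integrable) simp
  then show ?thesis by (rule Bochner_Integration.integrable_cong[THEN iffD1, rotated -1]) auto
qed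

text \<open>Exposing the retained cells of \<open>H\<close> one after the other: given the cells already in
  \<open>T\<close>, the expected number of further ones is at most \<open>card T * B\<close>.\<close>

lemma moment_given_kept:
  assumes H: "H \<subseteq> grid M n"
    and B: "\<And>r. r \<in> grid M n \<Longrightarrow>
      (\<Sum>l\<le>n. real (card {q \<in> H. anc M (n - l) q = anc M (n - l) r}) * p ^ (n - l)) \<le> B"
    and B0: "B \<ge> 0"
    and T: "T \<subseteq> grid M n" "T \<noteq> {}" "card T \<le> j"
  shows "expectation (\<lambda>\<omega>. of_bool (T \<subseteq> ret n \<omega>) * real (card (H \<inter> ret n \<omega>)) ^ k)
    \<le> p ^ card (pathset n T) * (\<Prod>i<k. real (j + i) * B)"
  using T
proof (induction k arbitrary: T j)
  case 0
  have "expectation (\<lambda>\<omega>. of_bool (T \<subseteq> ret n \<omega>)) = expectation (indicator {\<omega> \<in> space P. T \<subseteq> ret n \<omega>})"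
    by (intro Bochner_Integration.integral_cong) (auto simp: indicator_def)
  also have "\<dots> = prob ({\<omega> \<in> space P. T \<subseteq> ret n \<omega>} \<inter> space P)"
    by (rule Bochner_Integration.integral_indicator)
  also have "{\<omega> \<in> space P. T \<subseteq> ret n \<omega>} \<inter> space P = {\<omega> \<in> space P. T \<subseteq> ret n \<omega>}" by auto
  finally show ?case using prob_all_kept[OF 0(1)] by simp
next
  case (Suc k)
  have finH: "finite H" using H by (rule finite_subset) simp
  have finT: "finite T" using Suc.prems(1) by (rule finite_subset) simp
  have card_eq: "real (card (H \<inter> S)) = (\<Sum>q\<in>H. of_bool (q \<in> S))" for S
    using finH by (simp add: of_bool_def sum.If_cases Int_def)
  \<comment> \<open>One factor of the power is expanded over the cell \<open>q\<close> that it
    counts, and \<open>q\<close> joins the cells required to be retained.\<close>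
  have "of_bool (T \<subseteq> S) * real (card (H \<inter> S)) ^ Suc k
      = (\<Sum>q\<in>H. of_bool (insert q T \<subseteq> S) * real (card (H \<inter> S)) ^ k)" for S
    by (auto simp: card_eq[of S] sum_distrib_right)
  then have "expectation (\<lambda>\<omega>. of_bool (T \<subseteq> ret n \<omega>) * real (card (H \<inter> ret n \<omega>)) ^ Suc k)
      = expectation (\<lambda>\<omega>. \<Sum>q\<in>H. of_bool (insert q T \<subseteq> ret n \<omega>) * real (card (H \<inter> ret n \<omega>)) ^ k)"
    by simp
  also have "\<dots> = (\<Sum>q\<in>H. expectation (\<lambda>\<omega>. of_bool (insert q T \<subseteq> ret n \<omega>) * real (card (H \<inter> ret n \<omega>)) ^ k))"
    by (intro Bochner_Integration.integral_sum ret_integrable')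
  \<comment> \<open>Since \<open>q\<close> may already lie in \<open>T\<close>, it is the bound
    \<open>j\<close> on the size that grows by one.\<close>
  also have "\<dots> \<le> (\<Sum>q\<in>H. p ^ card (pathset n (insert q T)) * (\<Prod>i<k. real (Suc j + i) * B))"
    using Suc.prems H finT by (intro sum_mono Suc.IH) (auto intro: order_trans[OF card_insert_le_m1] simp: card_insert_if)
  also have "\<dots> = (\<Sum>q\<in>H. p ^ card (pathset n (insert q T))) * (\<Prod>i<k. real (Suc j + i) * B)"
    by (simp add: sum_distrib_right)
  also have "\<dots> \<le> (p ^ card (pathset n T) * (real (card T) * B)) * (\<Prod>i<k. real (Suc j + i) * B)"
    using Suc.prems B0 by (intro mult_right_mono sum_new_path_le H B prod_nonneg) auto
  also have "\<dots> \<le> (p ^ card (pathset n T) * (real j * B)) * (\<Prod>i<k. real (Suc j + i) * B)"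
    using Suc.prems B0 p_pos by (intro mult_right_mono mult_left_mono prod_nonneg) auto
  also have "\<dots> = p ^ card (pathset n T) * (\<Prod>i<Suc k. real (j + i) * B)"
    by (subst prod.lessThan_Suc_shift) simp
  finally show ?case .
qed

text \<open>Weights refer to a cell known to be retained, so the first factor of the power is
  expanded separately and the exposure starts from a singleton. The factors \<open>B\<close>,
  \<open>1 * B\<close>, \<open>2 * B\<close> and so on then produce the factorial.\<close>

lemma moment_bound:
  assumes H: "H \<subseteq> grid M n"
    and B: "\<And>r. r \<in> grid M n \<Longrightarrow>
      (\<Sum>l\<le>n. real (card {q \<in> H. anc M (n - l) q = anc M (n - l) r}) * p ^ (n - l)) \<le> B"
    and k: "k > 0"
  shows "expectation (\<lambda>\<omega>. real (card (H \<inter> ret n \<omega>)) ^ k) \<le> fact k * B ^ k"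
proof -
  have finH: "finite H" using H by (rule finite_subset) simp
  have card_eq: "real (card (H \<inter> S)) = (\<Sum>q\<in>H. of_bool (q \<in> S))" for S
    using finH by (simp add: of_bool_def sum.If_cases Int_def)
  have g0: "(0, 0) \<in> grid M n" using M_pos by (simp add: grid_def)
  have B0: "B \<ge> 0"
    using p_pos by (intro order_trans[OF _ B[OF g0]] sum_nonneg) auto
  obtain k' where k': "k = Suc k'" using k gr0_implies_Suc by blast
  have "real (card (H \<inter> S)) ^ k = (\<Sum>q\<in>H. of_bool ({q} \<subseteq> S) * real (card (H \<inter> S)) ^ k')" for S
    by (auto simp: card_eq[of S] k' sum_distrib_right)
  then have "expectation (\<lambda>\<omega>. real (card (H \<inter> ret n \<omega>)) ^ k)
      = expectation (\<lambda>\<omega>. \<Sum>q\<in>H. of_bool ({q} \<subseteq> ret n \<omega>) * real (card (H \<inter> ret n \<omega>)) ^ k')"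
    by simp
  also have "\<dots> = (\<Sum>q\<in>H. expectation (\<lambda>\<omega>. of_bool ({q} \<subseteq> ret n \<omega>) * real (card (H \<inter> ret n \<omega>)) ^ k'))"
    by (intro Bochner_Integration.integral_sum ret_integrable')
  also have "\<dots> \<le> (\<Sum>q\<in>H. p ^ card (pathset n {q}) * (\<Prod>i<k'. real (1 + i) * B))"
    using H B B0 by (intro sum_mono moment_given_kept) auto
  also have "\<dots> = real (card H) * p ^ n * (\<Prod>i<k'. real (1 + i) * B)"
    by (simp add: pathset_def card_path)
  also have "\<dots> \<le> B * (\<Prod>i<k'. real (1 + i) * B)"
  proof (intro mult_right_mono prod_nonneg)
    \<comment> \<open>Everything shares the root, so the term \<open>l = 0\<close> of the weight is
      the full mean size of \<open>H\<close>.\<close>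
    have "{q \<in> H. anc M n q = anc M n (0, 0)} = H"
      using H anc_grid_top g0 by (auto simp: subset_iff)
    then have "real (card H) * p ^ n = (\<Sum>l\<in>{0}. real (card {q \<in> H. anc M (n - l) q = anc M (n - l) (0, 0)}) * p ^ (n - l))"
      by simp
    also have "\<dots> \<le> (\<Sum>l\<le>n. real (card {q \<in> H. anc M (n - l) q = anc M (n - l) (0, 0)}) * p ^ (n - l))"
      using p_pos by (intro sum_mono2) auto
    also have "\<dots> \<le> B" by (rule B[OF g0])
    finally show "real (card H) * p ^ n \<le> B" .
  qed (use B0 in auto)
  also have "\<dots> = B * (fact k' * B ^ k')"
    by (simp add: prod.distrib fact_prod_Suc atLeast0LessThan)
  also have "\<dots> \<le> B * (fact k * B ^ k')"
    using B0 by (intro mult_left_mono mult_right_mono fact_mono) (auto simp: k')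
  also have "\<dots> = fact k * B ^ k" by (simp add: k')
  finally show ?thesis .
qed

end

lemma summable_poly_geometric: "summable (\<lambda>m. (real m + 1) ^ k * (1 / 2) ^ m)"
proof (rule summable_comparison_test_bigo)
  show "summable (\<lambda>m. norm ((3 / 4 :: real) ^ m))" by (simp add: summable_geometric)
  show "(\<lambda>m. (real m + 1) ^ k * (1 / 2) ^ m) \<in> O(\<lambda>m. (3 / 4) ^ m)" by real_asymp
qed

lemma finite_tube [simp]: "finite (tube M m t)"
  by (rule finite_subset[OF _ finite_grid[of M m]]) (auto simp: tube_def)

context percolation
begin

section \<open>Crowded tubes are improbable\<close>

text \<open>Growth rate per level inside a strip: about \<open>M\<close> children of a cell matter,
  each retained with probability \<open>p\<close>. The truncation at 1 makes
  \<open>(real M * p) ^ (m - l) \<le> mu ^ m\<close> hold for all \<open>l\<close>.\<close>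

definition mu :: real where "mu = max 1 (real M * p)"

lemma mu_ge_1: "mu \<ge> 1"
  by (simp add: mu_def)

definition tube_desc :: "nat \<Rightarrow> nat \<Rightarrow> int \<times> int \<times> nat \<times> nat \<Rightarrow> (nat \<times> nat) set" where
  "tube_desc m n t = {q \<in> grid M n. anc M (n - m) q \<in> tube M m t}"

definition tube_const :: real where "tube_const = 11 + lam / (lam - 1)"

text \<open>Provides the \<open>B\<close> of \<open>moment_bound\<close>. A common ancestor at a
  level \<open>l < m\<close> sees at most \<open>11 * M ^ (m - l)\<close> cells of the tube, whence
  the growth \<open>mu\<close>. From level \<open>m\<close> on all descendants are counted, and the
  geometric series is dominated by its largest term \<open>lam ^ (n - m)\<close>. The two ranges
  explain the two summands of \<open>tube_const\<close>.\<close>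

lemma tube_desc_weight_le:
  assumes lam: "lam > 1" and t: "t \<in> tube_params M m" and mn: "m \<le> n"
  shows "(\<Sum>l\<le>n. real (card {q \<in> tube_desc m n t. anc M (n - l) q = anc M (n - l) r}) * p ^ (n - l))
    \<le> tube_const * (real m + 1) * mu ^ m * lam ^ (n - m)"
proof -
  define f where "f l = real (card {q \<in> tube_desc m n t. anc M (n - l) q = anc M (n - l) r}) * p ^ (n - l)" for l
  have lo: "f l \<le> 11 * mu ^ m * lam ^ (n - m)" if l: "l < m" for l
  proof -
    define x where "x = anc M (n - l) r"
    define Y where "Y = {r' \<in> tube M m t. anc M (m - l) r' = x}"
    have nl: "n - l = (m - l) + (n - m)" using l mn by simp
    have finY: "finite Y" by (simp add: Y_def)
    have "{q \<in> tube_desc m n t. anc M (n - l) q = x} \<subseteq> (\<Union>r'\<in>Y. {q. anc M (n - m) q = r'})"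
      by (auto simp: tube_desc_def Y_def nl anc_anc)
    then have "card {q \<in> tube_desc m n t. anc M (n - l) q = x} \<le> card (\<Union>r'\<in>Y. {q. anc M (n - m) q = r'})"
      using finY card_anc_fibre(1)[OF M_pos] by (intro card_mono finite_UN_I) auto
    also have "\<dots> \<le> (\<Sum>r'\<in>Y. card {q. anc M (n - m) q = r'})"
      using finY by (rule card_UN_le)
    also have "\<dots> = card Y * M ^ (2 * (n - m))" by (simp add: card_anc_fibre(2)[OF M_pos])
    also have "\<dots> \<le> (11 * M ^ (m - l)) * M ^ (2 * (n - m))"
      unfolding Y_def using M_pos t by (intro mult_right_mono card_tube_fibre) auto
    finally have c: "real (card {q \<in> tube_desc m n t. anc M (n - l) q = x}) \<le> real ((11 * M ^ (m - l)) * M ^ (2 * (n - m)))"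
      by (rule of_nat_mono)
    have "f l \<le> real ((11 * M ^ (m - l)) * M ^ (2 * (n - m))) * p ^ (n - l)"
      unfolding f_def x_def[symmetric] using p_pos by (intro mult_right_mono c) auto
    also have "\<dots> = 11 * (real M * p) ^ (m - l) * lam ^ (n - m)"
      unfolding nl by (simp add: lam_def power_mult_distrib power_add power_mult)
    also have "\<dots> \<le> 11 * mu ^ (m - l) * lam ^ (n - m)"
      using p_pos lam by (intro mult_right_mono mult_left_mono power_mono) (auto simp: mu_def)
    also have "\<dots> \<le> 11 * mu ^ m * lam ^ (n - m)"
      using mu_ge_1 lam by (intro mult_right_mono mult_left_mono power_increasing) auto
    finally show ?thesis .
  qed
  have hi: "f l \<le> lam ^ (n - l)" for l
  proof -
    have "card {q \<in> tube_desc m n t. anc M (n - l) q = anc M (n - l) r} \<le> card {q. anc M (n - l) q = anc M (n - l) r}"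
      using card_anc_fibre(1)[OF M_pos] by (intro card_mono) auto
    also have "\<dots> = M ^ (2 * (n - l))" by (rule card_anc_fibre(2)[OF M_pos])
    finally have "f l \<le> real (M ^ (2 * (n - l))) * p ^ (n - l)"
      unfolding f_def using p_pos by (intro mult_right_mono of_nat_mono) auto
    then show ?thesis by (simp add: lam_def power_mult_distrib power_mult)
  qed
  have "(\<Sum>l\<le>n. f l) = (\<Sum>l<m. f l) + (\<Sum>l=m..n. f l)"
    by (subst sum.union_disjoint[symmetric]) (use mn in \<open>auto intro!: sum.cong\<close>)
  also have "(\<Sum>l<m. f l) \<le> (\<Sum>l<m. 11 * mu ^ m * lam ^ (n - m))"
    by (intro sum_mono lo) auto
  also have "(\<Sum>l=m..n. f l) \<le> (\<Sum>l=m..n. lam ^ (n - l))"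
    by (intro sum_mono hi)
  also have "(\<Sum>l=m..n. lam ^ (n - l)) = (\<Sum>i<Suc (n - m). lam ^ i)"
    by (rule sum.reindex_bij_witness[of _ "\<lambda>i. n - i" "\<lambda>l. n - l"]) (use mn in auto)
  also have "\<dots> = (lam ^ Suc (n - m) - 1) / (lam - 1)"
    using lam by (subst geometric_sum) auto
  also have "\<dots> \<le> lam ^ Suc (n - m) / (lam - 1)"
    using lam by (intro divide_right_mono) auto
  also have "\<dots> = (lam / (lam - 1)) * 1 * lam ^ (n - m)" by simp
  also have "\<dots> \<le> (lam / (lam - 1)) * ((real m + 1) * mu ^ m) * lam ^ (n - m)"
    using lam mu_ge_1 mult_mono[of 1 "real m + 1" 1 "mu ^ m"] by (intro mult_right_mono mult_left_mono) auto
  also have "(\<Sum>l<m. 11 * mu ^ m * lam ^ (n - m)) \<le> 11 * ((real m + 1) * mu ^ m) * lam ^ (n - m)"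
    using lam mu_ge_1 by (simp add: algebra_simps)
  finally have "(\<Sum>l\<le>n. f l) \<le> 11 * ((real m + 1) * mu ^ m) * lam ^ (n - m)
      + (lam / (lam - 1)) * ((real m + 1) * mu ^ m) * lam ^ (n - m)" by simp
  moreover have "11 * (a * b) * L + c * (a * b) * L = (11 + c) * a * b * L" for a b c L :: real
    by (simp add: algebra_simps)
  ultimately show ?thesis
    unfolding f_def tube_const_def by metis
qed

text \<open>Markov's inequality for the \<open>k\<close>-th power, with \<open>s\<close> as slack
  over the rate \<open>mu\<close>. The factor \<open>lam ^ (n - m)\<close> cancels, so the bound is
  independent of \<open>n\<close>.\<close>

lemma prob_tube_crowded:
  assumes lam: "lam > 1" and t: "t \<in> tube_params M m" and mn: "m \<le> n" and k: "k > 0" and s: "s > 0"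
  shows "prob {\<omega> \<in> space P. real (card (tube_desc m n t \<inter> ret n \<omega>)) > (s * mu) ^ m * lam ^ (n - m)}
    \<le> fact k * (tube_const * (real m + 1) / s ^ m) ^ k"
proof -
  define x where "x = (s * mu) ^ m * lam ^ (n - m)"
  have x: "x > 0" using s mu_ge_1 lam by (simp add: x_def)
  define B where "B = tube_const * (real m + 1) * mu ^ m * lam ^ (n - m)"
  define A where "A = {\<omega> \<in> space P. real (card (tube_desc m n t \<inter> ret n \<omega>)) > x}"
  have A [measurable]: "A \<in> events" unfolding A_def by (rule ret_event)
  have "x ^ k * prob A = expectation (\<lambda>\<omega>. x ^ k * indicator A \<omega>)" by simp
  also have "\<dots> \<le> expectation (\<lambda>\<omega>. real (card (tube_desc m n t \<inter> ret n \<omega>)) ^ k)"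
  proof (intro integral_mono ret_integrable')
    show "integrable P (\<lambda>\<omega>. x ^ k * indicator A \<omega>)" by (simp add: less_top[symmetric])
    fix \<omega>
    have "x ^ k \<le> real (card (tube_desc m n t \<inter> ret n \<omega>)) ^ k" if "\<omega> \<in> A"
      using that x by (intro power_mono) (auto simp: A_def)
    then show "x ^ k * indicator A \<omega> \<le> real (card (tube_desc m n t \<inter> ret n \<omega>)) ^ k"
      by (auto simp: indicator_def)
  qed
  also have "\<dots> \<le> fact k * B ^ k"
    unfolding B_def
    by (intro moment_bound k tube_desc_weight_le lam t mn) (auto simp: tube_desc_def)
  finally have "prob A \<le> fact k * B ^ k / x ^ k" using x by (simp add: pos_le_divide_eq mult.commute)
  also have "\<dots> = fact k * (B / x) ^ k" by (simp add: power_divide)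
  also have "B / x = tube_const * (real m + 1) / s ^ m"
    using s mu_ge_1 lam by (simp add: B_def x_def power_mult_distrib)
  finally show ?thesis by (simp add: A_def x_def)
qed

text \<open>For large \<open>k\<close> the decay in \<open>m\<close> of the bound for one tube beats
  the number of tubes. As \<open>n\<close> does not enter, the tail of one convergent series fixes
  \<open>m0\<close> for all \<open>n\<close> at once.\<close>

lemma prob_some_tube_crowded:
  assumes lam: "lam > 1" and s: "s > 1" and \<delta>: "\<delta> > 0"
  obtains m0 where "\<And>n. prob {\<omega> \<in> space P. \<exists>m\<in>{m0..n}. \<exists>t\<in>tube_params M m.
     real (card (tube_desc m n t \<inter> ret n \<omega>)) > (s * mu) ^ m * lam ^ (n - m)} \<le> \<delta>"
proof -
  define E where "E n m t = {\<omega> \<in> space P. real (card (tube_desc m n t \<inter> ret n \<omega>)) > (s * mu) ^ m * lam ^ (n - m)}" for n m t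
  have Ee: "E n m t \<in> events" for n m t unfolding E_def by (rule ret_event)
  \<comment> \<open>The number of tubes per level grows like \<open>M ^ (3 * m)\<close>; the extra 2
    leaves the summable factor \<open>(1 / 2) ^ m\<close>.\<close>
  obtain k0 where k0: "2 * real M ^ 3 < s ^ k0" using real_arch_pow[OF s] by blast
  define k where "k = Suc k0"
  have k: "2 * real M ^ 3 \<le> s ^ k" "k > 0"
    using k0 s by (auto simp: k_def intro: order_trans[OF less_imp_le power_increasing[of k0 "Suc k0"], of _ s, simplified])
  define K where "K = 6 * fact k * tube_const ^ k"
  define g where "g m = K * ((real m + 1) ^ k * (1 / 2) ^ m)" for m
  have C0: "tube_const \<ge> 0" using lam by (simp add: tube_const_def)
  then have g0: "g m \<ge> 0" for m by (simp add: g_def K_def)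
  have one: "prob (\<Union>t\<in>tube_params M m. E n m t) \<le> g m" if mn: "m \<le> n" for n m
  proof -
    have "prob (\<Union>t\<in>tube_params M m. E n m t) \<le> (\<Sum>t\<in>tube_params M m. prob (E n m t))"
      using finite_tube_params Ee by (intro finite_measure_subadditive_finite) auto
    also have "\<dots> \<le> (\<Sum>t\<in>tube_params M m. fact k * (tube_const * (real m + 1) / s ^ m) ^ k)"
      unfolding E_def using s by (intro sum_mono prob_tube_crowded lam mn k) auto
    also have "\<dots> = real (card (tube_params M m)) * (fact k * (tube_const * (real m + 1) / s ^ m) ^ k)"
      by simp
    also have "\<dots> \<le> real (6 * M ^ (3 * m)) * (fact k * (tube_const * (real m + 1) / s ^ m) ^ k)"
      using C0 s by (intro mult_right_mono of_nat_mono card_tube_params_le M_pos) auto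
    also have "\<dots> = K * ((real m + 1) ^ k * (real M ^ 3 / s ^ k) ^ m)"
    proof -
      have "(s ^ m) ^ k = (s ^ k) ^ m" by (metis mult.commute power_mult)
      then have "(tube_const * (real m + 1) / s ^ m) ^ k = tube_const ^ k * (real m + 1) ^ k / (s ^ k) ^ m"
        by (simp add: power_divide power_mult_distrib)
      moreover have "real (6 * M ^ (3 * m)) = 6 * (real M ^ 3) ^ m" by (simp add: power_mult)
      ultimately show ?thesis by (simp add: K_def power_divide)
    qed
    also have "\<dots> \<le> g m"
      unfolding g_def using C0 k s by (intro mult_left_mono power_mono) (auto simp: K_def pos_divide_le_eq)
    finally show ?thesis .
  qed
  have sg: "summable g" unfolding g_def by (intro summable_mult summable_poly_geometric)
  have "(\<lambda>m. \<Sum>i. g (i + m)) \<longlonglongrightarrow> 0" by (rule suminf_exist_split2[OF sg])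
  then have "\<forall>\<^sub>F m in sequentially. (\<Sum>i. g (i + m)) < \<delta>" using \<delta> by (rule order_tendstoD)
  then obtain m0 where m0: "(\<Sum>i. g (i + m0)) < \<delta>" using eventually_happens by fastforce
  have "prob {\<omega> \<in> space P. \<exists>m\<in>{m0..n}. \<exists>t\<in>tube_params M m.
     real (card (tube_desc m n t \<inter> ret n \<omega>)) > (s * mu) ^ m * lam ^ (n - m)} \<le> \<delta>" for n
  proof -
    have "{\<omega> \<in> space P. \<exists>m\<in>{m0..n}. \<exists>t\<in>tube_params M m.
        real (card (tube_desc m n t \<inter> ret n \<omega>)) > (s * mu) ^ m * lam ^ (n - m)}
        = (\<Union>m\<in>{m0..n}. \<Union>t\<in>tube_params M m. E n m t)"
      by (auto simp: E_def)
    also have "prob \<dots> \<le> (\<Sum>m=m0..n. prob (\<Union>t\<in>tube_params M m. E n m t))"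
      using finite_tube_params Ee by (intro finite_measure_subadditive_finite) auto
    also have "\<dots> \<le> (\<Sum>m=m0..n. g m)" by (intro sum_mono one) auto
    also have "\<dots> = (\<Sum>i<Suc n - m0. g (i + m0))"
      by (rule sum.reindex_bij_witness[of _ "\<lambda>i. i + m0" "\<lambda>m. m - m0"]) auto
    also have "\<dots> \<le> (\<Sum>i. g (i + m0))"
      using sg g0 by (intro sum_le_suminf) (auto simp: summable_iff_shift)
    finally show ?thesis using m0 by simp
  qed
  then show ?thesis by (rule that)
qed

section \<open>Typical levels occur infinitely often\<close>

text \<open>A property of a finite set of cells rather than of an outcome, so that
  \<open>ret_event\<close> applies at every level. Here \<open>c\<close> records the growth,
  \<open>s\<close> the slack and \<open>m0\<close> the scale from which tubes are
  controlled.\<close>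

definition typical :: "real \<Rightarrow> real \<Rightarrow> nat \<Rightarrow> nat \<Rightarrow> (nat \<times> nat) set \<Rightarrow> bool" where
  "typical s c m0 n S \<longleftrightarrow> c * lam ^ n \<le> real (card S) \<and>
     (\<forall>m\<in>{m0..n}. \<forall>t\<in>tube_params M m. real (card (tube_desc m n t \<inter> S)) \<le> (s * mu) ^ m * lam ^ (n - m))"

text \<open>There are three ways to fail, each allowed \<open>\<delta> / 3\<close>: generation
  \<open>m\<close> is nonempty but small, it is large but grows badly afterwards, or some tube is
  crowded. None of \<open>m\<close>, \<open>m0\<close>, \<open>j\<close> depends on
  \<open>n\<close>.\<close>

lemma prob_survive_not_typical:
  assumes lam: "lam > 1" and s: "s > 1" and \<delta>: "\<delta> > 0"
  obtains m m0 j where "\<And>n. n \<ge> m \<Longrightarrow>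
    prob {\<omega> \<in> space P. ret m \<omega> \<noteq> {} \<and> \<not> typical s (1 / real (Suc j)) m0 n (ret n \<omega>)} \<le> \<delta>"
proof -
  have "\<exists>m k. k > 0 \<and> prob {\<omega> \<in> space P. 1 \<le> card (ret m \<omega>) \<and> card (ret m \<omega>) < k} \<le> \<delta> / 3 \<and>
      4 * (1 - p) / ((lam - 1) * real k) \<le> \<delta> / 3"
  proof (cases "p = 1")
    \<comment> \<open>Without randomness the variance bound vanishes, and the root alone serves as
      the large generation.\<close>
    case True
    have "{\<omega> \<in> space P. 1 \<le> card (ret 0 \<omega>) \<and> card (ret 0 \<omega>) < 1} = {}" by auto
    then show ?thesis using True \<delta> by (intro exI[of _ 0] exI[of _ 1]) simp
  next
    case False
    then have p1: "p < 1" using p_le_1 by simp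
    have "(\<lambda>k. 4 * (1 - p) / ((lam - 1) * real k)) \<longlonglongrightarrow> 0"
      using lam p1 by real_asymp
    then have "\<forall>\<^sub>F k in sequentially. 4 * (1 - p) / ((lam - 1) * real k) < \<delta> / 3"
      using \<delta> by (intro order_tendstoD) auto
    then have "\<forall>\<^sub>F k in sequentially. 4 * (1 - p) / ((lam - 1) * real k) < \<delta> / 3 \<and> k > 0"
      by (intro eventually_conj eventually_gt_at_top)
    then obtain k :: nat where k: "4 * (1 - p) / ((lam - 1) * real k) < \<delta> / 3" "k > 0"
      using eventually_happens by fastforce
    have "\<forall>\<^sub>F m in sequentially. prob {\<omega> \<in> space P. 1 \<le> card (ret m \<omega>) \<and> card (ret m \<omega>) < k} < \<delta> / 3"
      using \<delta> small_generation_tendsto_0[OF p1, of k] by (intro order_tendstoD) auto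
    then obtain m where "prob {\<omega> \<in> space P. 1 \<le> card (ret m \<omega>) \<and> card (ret m \<omega>) < k} < \<delta> / 3"
      using eventually_happens by fastforce
    then show ?thesis using k by (intro exI[of _ m] exI[of _ k]) auto
  qed
  then obtain m k where mk: "k > 0"
    "prob {\<omega> \<in> space P. 1 \<le> card (ret m \<omega>) \<and> card (ret m \<omega>) < k} \<le> \<delta> / 3"
    "4 * (1 - p) / ((lam - 1) * real k) \<le> \<delta> / 3" by blast
  obtain m0 where m0: "\<And>n. prob {\<omega> \<in> space P. \<exists>m\<in>{m0..n}. \<exists>t\<in>tube_params M m.
     real (card (tube_desc m n t \<inter> ret n \<omega>)) > (s * mu) ^ m * lam ^ (n - m)} \<le> \<delta> / 3"
    using prob_some_tube_crowded[OF lam s, of "\<delta> / 3"] \<delta> by auto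
  \<comment> \<open>Growth is counted from level \<open>m\<close>; a constant below
    \<open>1 / (2 * lam ^ m)\<close> turns \<open>lam ^ (n - m) / 2\<close> into a multiple of
    \<open>lam ^ n\<close>. The form \<open>1 / real (Suc j)\<close> keeps the constants
    countable.\<close>
  obtain j where j: "inverse (real (Suc j)) < 1 / (2 * lam ^ m)"
    using reals_Archimedean[of "1 / (2 * lam ^ m)"] lam by auto
  show ?thesis
  proof (rule that[of m j m0])
    fix n assume n: "n \<ge> m"
    define A1 where "A1 = {\<omega> \<in> space P. 1 \<le> card (ret m \<omega>) \<and> card (ret m \<omega>) < k}"
    define A2 where "A2 = {\<omega> \<in> space P. card (ret m \<omega>) \<ge> k \<and> real (card (ret (m + (n - m)) \<omega>)) < lam ^ (n - m) / 2}"
    define A3 where "A3 = {\<omega> \<in> space P. \<exists>m\<in>{m0..n}. \<exists>t\<in>tube_params M m.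
       real (card (tube_desc m n t \<inter> ret n \<omega>)) > (s * mu) ^ m * lam ^ (n - m)}"
    have e3: "A3 \<in> events" unfolding A3_def by (rule ret_event)
    have e1: "A1 \<in> events" unfolding A1_def by (rule ret_event)
    have "{\<omega> \<in> space P. card (ret m \<omega>) \<ge> k} \<inter> {\<omega> \<in> space P. real (card (ret (m + (n - m)) \<omega>)) < lam ^ (n - m) / 2} \<in> events"
      by (intro sets.Int ret_event)
    then have e2: "A2 \<in> events" unfolding A2_def by (rule rev_iffD1) (auto intro!: arg_cong[of _ _ "\<lambda>A. A \<in> events"])
    have c: "1 / real (Suc j) * lam ^ n \<le> lam ^ (n - m) / 2"
    proof -
      have "1 / real (Suc j) * lam ^ n \<le> 1 / (2 * lam ^ m) * lam ^ n"
        using j lam by (intro mult_right_mono) (auto simp: inverse_eq_divide)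
      also have "\<dots> = lam ^ (n - m) / 2" using n lam by (simp add: power_diff)
      finally show ?thesis .
    qed
    have "{\<omega> \<in> space P. ret m \<omega> \<noteq> {} \<and> \<not> typical s (1 / real (Suc j)) m0 n (ret n \<omega>)} \<subseteq> A1 \<union> (A2 \<union> A3)"
    proof
      fix \<omega> assume "\<omega> \<in> {\<omega> \<in> space P. ret m \<omega> \<noteq> {} \<and> \<not> typical s (1 / real (Suc j)) m0 n (ret n \<omega>)}"
      then have w: "\<omega> \<in> space P" "ret m \<omega> \<noteq> {}" "\<not> typical s (1 / real (Suc j)) m0 n (ret n \<omega>)" by auto
      have c1: "1 \<le> card (ret m \<omega>)" using w(2) finite_retained[OF M_pos] by (simp add: Suc_le_eq card_gt_0_iff)
      show "\<omega> \<in> A1 \<union> (A2 \<union> A3)"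
      proof (cases "real (card (ret n \<omega>)) < 1 / real (Suc j) * lam ^ n")
        case True
        then have "real (card (ret n \<omega>)) < lam ^ (n - m) / 2" using c by linarith
        then show ?thesis using w(1) c1 n by (auto simp: A1_def A2_def)
      next
        case False
        then have "\<omega> \<in> A3" using w unfolding typical_def A3_def by (auto simp: not_le)
        then show ?thesis by simp
      qed
    qed
    then have "prob {\<omega> \<in> space P. ret m \<omega> \<noteq> {} \<and> \<not> typical s (1 / real (Suc j)) m0 n (ret n \<omega>)} \<le> prob (A1 \<union> (A2 \<union> A3))"
      using e1 e2 e3 by (intro finite_measure_mono) auto
    also have "\<dots> \<le> prob A1 + (prob A2 + prob A3)"
      using measure_Un_le[OF e1 sets.Un[OF e2 e3]] measure_Un_le[OF e2 e3] by linarith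
    also have "prob A1 \<le> \<delta> / 3" unfolding A1_def by (rule mk)
    also have "prob A2 \<le> \<delta> / 3"
      unfolding A2_def using growth_after_large_generation[OF mk(1) lam, of m "n - m"] mk(3) by linarith
    also have "prob A3 \<le> \<delta> / 3" unfolding A3_def by (rule m0)
    finally show "prob {\<omega> \<in> space P. ret m \<omega> \<noteq> {} \<and> \<not> typical s (1 / real (Suc j)) m0 n (ret n \<omega>)} \<le> \<delta>" by simp
  qed
qed

text \<open>The failure probabilities are small at each level but not known to be summable over
  levels. Failing at all large levels is still at most as likely as failing at a single one, which
  yields typical levels infinitely often.\<close>

lemma AE_frequently_typical:
  assumes lam: "lam > 1" and s: "s > 1"
  shows "AE \<omega> in P. (\<forall>m. ret m \<omega> \<noteq> {}) \<longrightarrow>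
    (\<exists>c>0. \<exists>m0. \<exists>\<^sub>F n in sequentially. typical s c m0 n (ret n \<omega>))"
proof -
  define B where "B = {\<omega> \<in> space P. (\<forall>m. ret m \<omega> \<noteq> {}) \<and>
    (\<forall>j m0. \<exists>N. \<forall>n\<ge>N. \<not> typical s (1 / real (Suc j)) m0 n (ret n \<omega>))}"
  have ne: "{\<omega> \<in> space P. ret m \<omega> \<noteq> {}} \<in> events" for m by (rule ret_event)
  have nt: "{\<omega> \<in> space P. \<forall>n\<ge>N. \<not> typical s c m0 n (ret n \<omega>)} \<in> events" for N c m0
  proof (rule sets.sets_Collect_countable_All)
    show "{\<omega> \<in> space P. n \<ge> N \<longrightarrow> \<not> typical s c m0 n (ret n \<omega>)} \<in> events" for n
      by (rule ret_event)
  qed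
  have B: "B \<in> events"
    unfolding B_def
    by (rule sets.sets_Collect_conj, (rule sets.sets_Collect_countable_All)+, rule sets.sets_Collect_countable_Ex,
        rule nt, rule sets.sets_Collect_countable_All, rule ne)
  have le: "prob B \<le> \<delta>" if \<delta>: "\<delta> > 0" for \<delta>
  proof -
    obtain m m0 j where *: "\<And>n. n \<ge> m \<Longrightarrow>
      prob {\<omega> \<in> space P. ret m \<omega> \<noteq> {} \<and> \<not> typical s (1 / real (Suc j)) m0 n (ret n \<omega>)} \<le> \<delta>"
      by (rule prob_survive_not_typical[OF lam s \<delta>]) (rule that)
    \<comment> \<open>\<open>A N\<close> increases with \<open>N\<close> and lies in the failure
      event of the single level \<open>max N m\<close>, so the union still has probability at most
      \<open>\<delta>\<close>.\<close>
    define A where "A N = {\<omega> \<in> space P. ret m \<omega> \<noteq> {} \<and> (\<forall>n\<ge>N. \<not> typical s (1 / real (Suc j)) m0 n (ret n \<omega>))}" for N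
    have A: "A N \<in> events" for N
      unfolding A_def by (rule sets.sets_Collect_conj[OF nt ne])
    have "prob (A N) \<le> \<delta>" for N
    proof -
      define A' where "A' = {\<omega> \<in> space P. ret m \<omega> \<noteq> {} \<and> \<not> typical s (1 / real (Suc j)) m0 (max N m) (ret (max N m) \<omega>)}"
      have "A' \<in> events" unfolding A'_def by (rule sets.sets_Collect_conj[OF ret_event ne])
      then have "prob (A N) \<le> prob A'"
        by (intro finite_measure_mono) (auto simp: A_def A'_def)
      then show ?thesis using *[of "max N m"] by (simp add: A'_def)
    qed
    moreover have "(\<lambda>N. prob (A N)) \<longlonglongrightarrow> prob (\<Union>N. A N)"
      by (intro finite_Lim_measure_incseq) (use A in \<open>auto simp: A_def incseq_def\<close>)
    ultimately have "prob (\<Union>N. A N) \<le> \<delta>" by (intro LIMSEQ_le_const2) auto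
    moreover have "prob B \<le> prob (\<Union>N. A N)"
    proof (intro finite_measure_mono)
      show "B \<subseteq> (\<Union>N. A N)" unfolding B_def A_def by blast
      show "(\<Union>N. A N) \<in> events" using A by auto
    qed
    ultimately show ?thesis by simp
  qed
  have "prob B \<le> 0"
  proof (rule field_le_epsilon)
    show "prob B \<le> 0 + \<delta>" if "\<delta> > 0" for \<delta> using le[OF that] by simp
  qed
  then have "prob B = 0" using measure_nonneg[of P B] by linarith
  then have "B \<in> null_sets P" using B by (intro null_setsI) (auto simp: emeasure_eq_measure)
  then have "AE \<omega> in P. \<omega> \<notin> B" by (rule AE_not_in)
  moreover have "AE \<omega> in P. \<omega> \<in> space P" by (rule AE_space)
  ultimately show ?thesis
  proof eventually_elim
    case (elim \<omega>)
    show ?case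
    proof
      assume "\<forall>m. ret m \<omega> \<noteq> {}"
      then obtain j m0 where "\<forall>N. \<exists>n\<ge>N. typical s (1 / real (Suc j)) m0 n (ret n \<omega>)"
        using elim unfolding B_def by blast
      then have "\<exists>\<^sub>F n in sequentially. typical s (1 / real (Suc j)) m0 n (ret n \<omega>)"
        unfolding frequently_def eventually_sequentially by blast
      then show "\<exists>c>0. \<exists>m0. \<exists>\<^sub>F n in sequentially. typical s c m0 n (ret n \<omega>)"
        by (intro exI[of _ "1 / real (Suc j)"]) auto
    qed
  qed
qed

end

section \<open>Geometry of the percolation set\<close>

lemma mem_square:
  "x \<in> square M n q \<longleftrightarrow>
    real (fst q) / real M ^ n \<le> x $ 1 \<and> x $ 1 \<le> (real (fst q) + 1) / real M ^ n \<and>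
    real (snd q) / real M ^ n \<le> x $ 2 \<and> x $ 2 \<le> (real (snd q) + 1) / real M ^ n"
  by (cases q) (auto simp: square_def mem_box_cart forall_2)

lemma mem_square_scaled:
  assumes "M > 0"
  shows "x \<in> square M n q \<longleftrightarrow>
    real (fst q) \<le> real M ^ n * x $ 1 \<and> real M ^ n * x $ 1 \<le> real (fst q) + 1 \<and>
    real (snd q) \<le> real M ^ n * x $ 2 \<and> real M ^ n * x $ 2 \<le> real (snd q) + 1"
  using assms by (simp add: mem_square pos_divide_le_eq pos_le_divide_eq mult.commute)

lemma compact_square: "compact (square M n q)"
  by (cases q) (simp add: square_def)

lemma square_nonempty: "M > 0 \<Longrightarrow> square M n q \<noteq> {}"
proof -
  assume M: "M > 0"
  have "(vector [real (fst q) / real M ^ n, real (snd q) / real M ^ n] :: real^2) \<in> square M n q"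
    using M by (auto simp: mem_square divide_right_mono)
  then show ?thesis by blast
qed

lemma diameter_square_le:
  assumes "M > 0"
  shows "diameter (square M n q) \<le> 2 / real M ^ n"
proof (rule diameter_le)
  have M: "real M ^ n > 0" using assms by simp
  show "square M n q \<noteq> {} \<or> 0 \<le> 2 / real M ^ n" using M by simp
  fix x y assume xy: "x \<in> square M n q" "y \<in> square M n q"
  have "norm (x - y) \<le> (\<Sum>i\<in>UNIV. \<bar>(x - y) $ i\<bar>)" by (rule norm_le_l1_cart)
  also have "\<dots> = \<bar>x $ 1 - y $ 1\<bar> + \<bar>x $ 2 - y $ 2\<bar>" by (simp add: sum_2)
  also have "\<bar>x $ 1 - y $ 1\<bar> \<le> 1 / real M ^ n" using xy by (simp add: mem_square add_divide_distrib abs_le_iff)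
  also have "\<bar>x $ 2 - y $ 2\<bar> \<le> 1 / real M ^ n" using xy by (simp add: mem_square add_divide_distrib abs_le_iff)
  finally show "norm (x - y) \<le> 2 / real M ^ n" by simp
qed

lemma square_anc:
  assumes "M > 0" "d \<le> n" "x \<in> square M n q"
  shows "x \<in> square M (n - d) (anc M d q)"
proof -
  define D where "D = M ^ d"
  have D: "D > 0" using assms by (simp add: D_def)
  have Mn: "real M ^ n = real M ^ (n - d) * real D" using assms(2) by (simp add: D_def flip: power_add)
  \<comment> \<open>For integers, \<open>i < (i div D + 1) * D\<close> improves by one, as the upper
    side of the larger cell requires.\<close>
  have b: "real (i div D) * real D \<le> real i" "real i + 1 \<le> (real (i div D) + 1) * real D" for i
  proof -
    have "(i div D) * D \<le> i" by (rule div_times_less_eq_dividend)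
    then show "real (i div D) * real D \<le> real i" by (metis of_nat_mono of_nat_mult)
    have "i < D + i div D * D" using dividend_less_div_times[OF D] .
    then have "i + 1 \<le> (i div D + 1) * D" by (simp add: algebra_simps)
    then have "real (i + 1) \<le> real ((i div D + 1) * D)" by (rule of_nat_mono)
    then show "real i + 1 \<le> (real (i div D) + 1) * real D" by (simp add: algebra_simps)
  qed
  have c: "real (i div D) \<le> real M ^ (n - d) * z \<and> real M ^ (n - d) * z \<le> real (i div D) + 1"
    if "real i \<le> real M ^ n * z" "real M ^ n * z \<le> real i + 1" for i z
  proof -
    have "real (i div D) * real D \<le> (real M ^ (n - d) * z) * real D"
      "(real M ^ (n - d) * z) * real D \<le> (real (i div D) + 1) * real D"
      using b[of i] that unfolding Mn by (auto simp: mult_ac intro: order_trans)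
    then show ?thesis using D by simp
  qed
  show ?thesis
    using assms(3) c[of "fst q" "x $ 1"] c[of "snd q" "x $ 2"]
    unfolding mem_square_scaled[OF assms(1)] by (simp add: anc_def D_def)
qed

lemma compact_percolation_level:
  assumes "M > 0"
  shows "compact (percolation_level M R \<omega> n)"
  unfolding percolation_level_def using assms by (intro compact_UN compact_square) simp

lemma percolation_level_antimono:
  assumes "M > 0" "m \<le> n"
  shows "percolation_level M R \<omega> n \<subseteq> percolation_level M R \<omega> m"
proof
  fix x assume "x \<in> percolation_level M R \<omega> n"
  then obtain q where q: "q \<in> retained M R \<omega> n" "x \<in> square M n q" by (auto simp: percolation_level_def)
  have "anc M (n - m) q \<in> retained M R \<omega> m"
    using anc_retained[OF assms(1) q(1), of "n - m"] assms(2) by simp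
  moreover have "x \<in> square M m (anc M (n - m) q)"
    using square_anc[OF assms(1) _ q(2), of "n - m"] assms(2) by simp
  ultimately show "x \<in> percolation_level M R \<omega> m" by (auto simp: percolation_level_def)
qed

lemma percolation_set_subset_level:
  "n \<ge> 1 \<Longrightarrow> percolation_set M R \<omega> \<subseteq> percolation_level M R \<omega> n"
  by (auto simp: percolation_set_def)

lemma compact_percolation_set:
  assumes "M > 0"
  shows "compact (percolation_set M R \<omega>)"
  unfolding percolation_set_def
  by (intro compact_Inter) (use compact_percolation_level[OF assms] in auto)

text \<open>If every level left \<open>U\<close>, the nonempty compact differences would decrease to
  a point of the percolation set outside \<open>U\<close>.\<close>

lemma percolation_level_subset_open:
  assumes M: "M > 0" and U: "open U" "percolation_set M R \<omega> \<subseteq> U"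
  obtains N where "\<And>n. n \<ge> N \<Longrightarrow> percolation_level M R \<omega> n \<subseteq> U"
proof -
  define F where "F n = percolation_level M R \<omega> (Suc n) - U" for n
  have anti: "percolation_level M R \<omega> n \<subseteq> percolation_level M R \<omega> m" if "m \<le> n" for m n
    using M that by (rule percolation_level_antimono)
  have "\<exists>n. F n = {}"
  proof (rule ccontr)
    assume "\<nexists>n. F n = {}"
    then have "\<Inter>(range F) \<noteq> {}"
    proof (intro compact_nest)
      show "compact (F n)" for n
        unfolding F_def by (rule compact_diff[OF compact_percolation_level[OF M] U(1)])
      show "F n \<subseteq> F m" if "m \<le> n" for m n
        using anti[of "Suc m" "Suc n"] that unfolding F_def by blast
    qed blast
    then obtain x where x: "\<And>n. x \<in> F n" by blast
    have "x \<in> percolation_set M R \<omega>"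
      unfolding percolation_set_def
    proof
      fix n :: nat assume "n \<in> {1..}"
      then show "x \<in> percolation_level M R \<omega> n" using x[of "n - 1"] by (simp add: F_def)
    qed
    then show False using U(2) x[of 0] by (auto simp: F_def)
  qed
  then obtain n where "F n = {}" by blast
  then have "percolation_level M R \<omega> m \<subseteq> U" if "m \<ge> Suc n" for m
    using anti[OF that] by (auto simp: F_def)
  then show ?thesis by (rule that)
qed

lemma retained_nonempty:
  assumes "percolation_set M R \<omega> \<noteq> {}"
  shows "retained M R \<omega> n \<noteq> {}"
proof (cases "n = 0")
  case False
  then show ?thesis
    using assms percolation_set_subset_level[of n M R \<omega>] by (auto simp: percolation_level_def)
qed simp

lemma null_percolation_set:
  assumes M: "M > 0" and t: "t > 0"
    and small: "\<And>e N. e > 0 \<Longrightarrow> \<exists>n\<ge>N. real (card (retained M R \<omega> n)) * (1 / real M ^ n) powr t \<le> e"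
    and M2: "M \<ge> 2"
  shows "hausdorff_measure t (percolation_set M R \<omega>) = 0"
proof (rule null_hausdorff_measureI[OF t])
  fix e :: real assume e: "e > 0"
  have "(\<lambda>n. 2 / real M ^ n) \<longlonglongrightarrow> 0" using M2 by real_asymp
  then have "\<forall>\<^sub>F n in sequentially. 2 / real M ^ n < e" using e by (rule order_tendstoD)
  then obtain N where N: "\<And>n. n \<ge> N \<Longrightarrow> 2 / real M ^ n < e" by (auto simp: eventually_sequentially)
  \<comment> \<open>Dividing by \<open>2 powr t\<close> compensates for the diameter bound
    \<open>2 / real M ^ n\<close>; \<open>n \<ge> 1\<close> is the range where the level is known to
    contain the percolation set.\<close>
  obtain n where n: "n \<ge> max N 1" "real (card (retained M R \<omega> n)) * (1 / real M ^ n) powr t \<le> e / 2 powr t"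
    using small[of "e / 2 powr t" "max N 1"] e by auto
  define \<D> where "\<D> = square M n ` retained M R \<omega> n"
  have "percolation_set M R \<omega> \<subseteq> \<Union>\<D>"
    using percolation_set_subset_level[of n M R \<omega>] n(1) by (simp add: percolation_level_def \<D>_def)
  moreover have "real (card \<D>) * (2 / real M ^ n) powr t \<le> e"
  proof -
    have "real (card \<D>) \<le> real (card (retained M R \<omega> n))"
      unfolding \<D>_def using M by (intro of_nat_mono card_image_le) simp
    then have "real (card \<D>) * (2 / real M ^ n) powr t
        \<le> real (card (retained M R \<omega> n)) * (2 * (1 / real M ^ n)) powr t"
      by (simp add: mult_right_mono)
    also have "\<dots> = 2 powr t * (real (card (retained M R \<omega> n)) * (1 / real M ^ n) powr t)"
      by (simp add: powr_mult powr_divide)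
    also have "\<dots> \<le> 2 powr t * (e / 2 powr t)" using n(2) by (intro mult_left_mono) auto
    finally show ?thesis by simp
  qed
  ultimately show "\<exists>\<D> d. finite \<D> \<and> percolation_set M R \<omega> \<subseteq> \<Union>\<D> \<and> 0 \<le> d \<and> d \<le> e \<and>
      (\<forall>D\<in>\<D>. bounded D \<and> diameter D \<le> d) \<and> real (card \<D>) * d powr t \<le> e"
    using N[of n] n(1) M compact_imp_bounded[OF compact_square] diameter_square_le[OF M]
    by (intro exI[of _ \<D>] exI[of _ "2 / real M ^ n"]) (auto simp: \<D>_def)
qed

section \<open>From strips to tubes\<close>

text \<open>Error budget: after scaling by \<open>N\<close> the strip contributes 2 and the offsets
  inside the cells contribute 1 for each coordinate. A further factor \<open>N\<close> and the
  rounding of the slope over a distance \<open>N\<close> give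
  \<open>(2 + 1 + 1) * N + N\<close>.\<close>

lemma lattice_tube_bound:
  fixes N :: real and b i0 j0 i j :: int
  assumes N: "N > 0" and v: "\<bar>v\<bar> \<le> 1" and b: "\<bar>of_int b - v * N\<bar> \<le> 1" and jj: "\<bar>of_int j - of_int j0\<bar> \<le> N"
    and x: "of_int i0 \<le> N * x1" "N * x1 \<le> of_int i0 + 1" "of_int j0 \<le> N * x2" "N * x2 \<le> of_int j0 + 1"
    and y: "of_int i \<le> N * y1" "N * y1 \<le> of_int i + 1" "of_int j \<le> N * y2" "N * y2 \<le> of_int j + 1"
    and d: "\<bar>(y1 - x1) + v * (y2 - x2)\<bar> \<le> 2 / N"
  shows "\<bar>N * (of_int i - of_int i0) + of_int b * (of_int j - of_int j0)\<bar> \<le> 5 * N"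
proof -
  define w where "w = (y1 - x1) + v * (y2 - x2)"
  define \<theta> where "\<theta> = (of_int i - of_int i0) - N * (y1 - x1)"
  define \<theta>' where "\<theta>' = (of_int j - of_int j0) - N * (y2 - x2)"
  have th: "\<bar>\<theta>\<bar> \<le> 1" "\<bar>\<theta>'\<bar> \<le> 1"
    using x y unfolding \<theta>_def \<theta>'_def right_diff_distrib by linarith+
  have "\<bar>N * w\<bar> = N * \<bar>w\<bar>" using N by (simp add: abs_mult)
  also have "\<dots> \<le> N * (2 / N)" using d N unfolding w_def[symmetric] by (intro mult_left_mono) auto
  finally have w: "\<bar>N * w\<bar> \<le> 2" using N by simp
  have vt: "\<bar>v * \<theta>'\<bar> \<le> 1" using v th(2) mult_mono[of "\<bar>v\<bar>" 1 "\<bar>\<theta>'\<bar>" 1] by (simp add: abs_mult)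
  have "\<bar>N * w + \<theta> + v * \<theta>'\<bar> \<le> 4" using w th(1) vt by linarith
  then have 1: "\<bar>N * (N * w + \<theta> + v * \<theta>')\<bar> \<le> N * 4"
    using N by (simp add: abs_mult)
  have "\<bar>of_int b - v * N\<bar> * \<bar>of_int j - of_int j0\<bar> \<le> 1 * N"
    using b jj by (intro mult_mono) auto
  then have 2: "\<bar>(of_int b - v * N) * (of_int j - of_int j0)\<bar> \<le> N" by (simp add: abs_mult)
  have "N * (of_int i - of_int i0) + of_int b * (of_int j - of_int j0)
      = N * (N * w + \<theta> + v * \<theta>') + (of_int b - v * N) * (of_int j - of_int j0)"
    by (simp add: w_def \<theta>_def \<theta>'_def algebra_simps)
  then show ?thesis using 1 2 by linarith
qed

text \<open>The larger component of a unit vector is at least 1/2 in modulus. Dividing by it gives a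
  slope \<open>v\<close> of modulus at most 1 and at most doubles the width. As the tube parameters
  are finite in number, a union bound can thus treat all directions at once.\<close>

lemma tube_of_strip:
  fixes u :: "real^2"
  assumes M: "M > 0" and u: "norm u = 1" and q0: "q0 \<in> grid M m"
  obtains t where "t \<in> tube_params M m"
    "\<And>x y q. x \<in> square M m q0 \<Longrightarrow> y \<in> square M m q \<Longrightarrow> q \<in> grid M m \<Longrightarrow>
       \<bar>(y - x) \<bullet> u\<bar> \<le> 1 / real M ^ m \<Longrightarrow> q \<in> tube M m t"
proof -
  define N where "N = real M ^ m"
  have N: "N > 0" using M by (simp add: N_def)
  have Ni: "real_of_int (int M ^ m) = N" by (simp add: N_def)
  obtain i0 j0 where q0': "q0 = (i0, j0)" by (cases q0)
  have ip: "(y - x) \<bullet> u = (y $ 1 - x $ 1) * u $ 1 + (y $ 2 - x $ 2) * u $ 2" for x y :: "real^2"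
    by (simp add: inner_vec_def sum_2)
  have u2: "(u $ 1)\<^sup>2 + (u $ 2)\<^sup>2 = 1"
    using u by (simp add: norm_eq_1 inner_vec_def sum_2 power2_eq_square)
  have half: "1 / 2 \<le> \<bar>a\<bar>" if "\<bar>b\<bar> \<le> \<bar>a\<bar>" "a\<^sup>2 + b\<^sup>2 = 1" for a b :: real
  proof -
    have "b\<^sup>2 \<le> a\<^sup>2" using that(1) by (simp add: abs_le_square_iff)
    then have "(1 / 2)\<^sup>2 \<le> a\<^sup>2" using that(2) by (simp add: power_divide)
    then show ?thesis unfolding abs_le_square_iff[symmetric] by simp
  qed
  have large: "\<bar>u $ 1\<bar> \<ge> 1 / 2" if "\<bar>u $ 2\<bar> \<le> \<bar>u $ 1\<bar>" using half[OF that u2] .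
  have large': "\<bar>u $ 2\<bar> \<ge> 1 / 2" if "\<bar>u $ 1\<bar> \<le> \<bar>u $ 2\<bar>"
    using half[OF that] u2 by (simp add: add.commute)
  have fl: "\<bar>real_of_int \<lfloor>v * N\<rfloor> - v * N\<bar> \<le> 1 \<and> \<bar>\<lfloor>v * N\<rfloor>\<bar> \<le> int M ^ m" if v: "\<bar>v\<bar> \<le> 1" for v
  proof -
    have "- N \<le> v * N" "v * N \<le> N" using v N
      mult_right_mono[of "-1" v N] mult_right_mono[of v 1 N] by (auto simp: abs_le_iff)
    then have "- (int M ^ m) \<le> \<lfloor>v * N\<rfloor>" "\<lfloor>v * N\<rfloor> \<le> int M ^ m"
      by (auto simp: le_floor_iff floor_le_iff N_def)
    moreover have "\<bar>real_of_int \<lfloor>v * N\<rfloor> - v * N\<bar> \<le> 1" by linarith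
    ultimately show ?thesis by simp
  qed
  have diff: "\<bar>real_of_int (int i) - real_of_int (int i')\<bar> \<le> N" if "i < M ^ m" "i' < M ^ m" for i i'
  proof -
    have "real i < N" "real i' < N"
      using that unfolding N_def by (metis of_nat_less_iff of_nat_power)+
    moreover have "real i \<ge> 0" "real i' \<ge> 0" by simp_all
    ultimately show ?thesis unfolding of_int_of_nat_eq by linarith
  qed
  have scale: "\<bar>z / c\<bar> \<le> 2 / N" if "\<bar>z\<bar> \<le> 1 / N" "\<bar>c\<bar> \<ge> 1 / 2" for z c :: real
  proof -
    have "\<bar>z\<bar> / \<bar>c\<bar> \<le> (1 / N) / (1 / 2)" using that N by (intro frac_le) auto
    then show ?thesis by simp
  qed
  consider "\<bar>u $ 2\<bar> \<le> \<bar>u $ 1\<bar>" | "\<bar>u $ 1\<bar> \<le> \<bar>u $ 2\<bar>" by linarith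
  then show ?thesis
  proof cases
    case 1
    define v where "v = u $ 2 / u $ 1"
    have u1: "u $ 1 \<noteq> 0" using large[OF 1] by auto
    have v: "\<bar>v\<bar> \<le> 1" using 1 u1 by (simp add: v_def)
    show ?thesis
    proof (rule that[of "(int M ^ m, \<lfloor>v * N\<rfloor>, i0, j0)"])
      show "(int M ^ m, \<lfloor>v * N\<rfloor>, i0, j0) \<in> tube_params M m"
        using q0 fl[OF v] by (simp add: tube_params_def q0')
      fix x y q assume xy: "x \<in> square M m q0" "y \<in> square M m q" "q \<in> grid M m" "\<bar>(y - x) \<bullet> u\<bar> \<le> 1 / real M ^ m"
      obtain i j where q: "q = (i, j)" by (cases q)
      have "(y $ 1 - x $ 1) + v * (y $ 2 - x $ 2) = ((y - x) \<bullet> u) / u $ 1"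
        using u1 by (simp add: ip v_def field_simps)
      then have d: "\<bar>(y $ 1 - x $ 1) + v * (y $ 2 - x $ 2)\<bar> \<le> 2 / N"
        using scale[of "(y - x) \<bullet> u" "u $ 1"] xy(4) large[OF 1] by (simp add: N_def)
      have "\<bar>N * (of_int (int i) - of_int (int i0)) + of_int \<lfloor>v * N\<rfloor> * (of_int (int j) - of_int (int j0))\<bar> \<le> 5 * N"
        using xy q0 fl[OF v] diff[of j j0] unfolding mem_square_scaled[OF M]
        by (intro lattice_tube_bound[OF N v _ _ _ _ _ _ _ _ _ _ d]) (auto simp: q q0' grid_def N_def)
      then have "real_of_int \<bar>int M ^ m * (int i - int i0) + \<lfloor>v * N\<rfloor> * (int j - int j0)\<bar> \<le> real_of_int (5 * int M ^ m)"
        by (simp add: N_def)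
      then have "\<bar>int M ^ m * (int i - int i0) + \<lfloor>v * N\<rfloor> * (int j - int j0)\<bar> \<le> 5 * int M ^ m"
        by (simp only: of_int_le_iff)
      then show "q \<in> tube M m (int M ^ m, \<lfloor>v * N\<rfloor>, i0, j0)" using xy(3) by (simp add: tube_def q)
    qed
  next
    case 2
    define v where "v = u $ 1 / u $ 2"
    have u1: "u $ 2 \<noteq> 0" using large'[OF 2] by auto
    have v: "\<bar>v\<bar> \<le> 1" using 2 u1 by (simp add: v_def)
    show ?thesis
    proof (rule that[of "(\<lfloor>v * N\<rfloor>, int M ^ m, i0, j0)"])
      show "(\<lfloor>v * N\<rfloor>, int M ^ m, i0, j0) \<in> tube_params M m"
        using q0 fl[OF v] by (simp add: tube_params_def q0')
      fix x y q assume xy: "x \<in> square M m q0" "y \<in> square M m q" "q \<in> grid M m" "\<bar>(y - x) \<bullet> u\<bar> \<le> 1 / real M ^ m"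
      obtain i j where q: "q = (i, j)" by (cases q)
      have "(y $ 2 - x $ 2) + v * (y $ 1 - x $ 1) = ((y - x) \<bullet> u) / u $ 2"
        using u1 by (simp add: ip v_def field_simps)
      then have d: "\<bar>(y $ 2 - x $ 2) + v * (y $ 1 - x $ 1)\<bar> \<le> 2 / N"
        using scale[of "(y - x) \<bullet> u" "u $ 2"] xy(4) large'[OF 2] by (simp add: N_def)
      have "\<bar>N * (of_int (int j) - of_int (int j0)) + of_int \<lfloor>v * N\<rfloor> * (of_int (int i) - of_int (int i0))\<bar> \<le> 5 * N"
        using xy q0 fl[OF v] diff[of i i0] unfolding mem_square_scaled[OF M]
        by (intro lattice_tube_bound[OF N v _ _ _ _ _ _ _ _ _ _ d]) (auto simp: q q0' grid_def N_def)
      then have "real_of_int \<bar>int M ^ m * (int j - int j0) + \<lfloor>v * N\<rfloor> * (int i - int i0)\<bar> \<le> real_of_int (5 * int M ^ m)"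
        by (simp add: N_def)
      then have "\<bar>\<lfloor>v * N\<rfloor> * (int i - int i0) + int M ^ m * (int j - int j0)\<bar> \<le> 5 * int M ^ m"
        by (simp only: of_int_le_iff add.commute)
      then show "q \<in> tube M m (\<lfloor>v * N\<rfloor>, int M ^ m, i0, j0)" using xy(3) by (simp add: tube_def q)
    qed
  qed
qed

section \<open>Dimension of the projections\<close>

text \<open>Rounds a diameter up to a power of \<open>1 / M\<close>, losing at most a factor
  \<open>M\<close>. Diameter 0 has no matching scale and is paid for by the error \<open>e\<close>.
  The strict \<open>d < 1 / real M ^ m\<close> makes room for open strips.\<close>

lemma scale_choice:
  assumes M: "M \<ge> 2" and t: "t > 0" and d: "0 \<le> d" "d < 1 / real M ^ m0" and e: "e > 0"
  obtains m where "m \<ge> m0" "d < 1 / real M ^ m" "(1 / real M ^ m) powr t \<le> real M powr t * d powr t + e"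
proof (cases "d = 0")
  case True
  have "(\<lambda>m. (1 / real M ^ m) powr t) \<longlonglongrightarrow> 0" using M t by real_asymp
  then have "\<forall>\<^sub>F m in sequentially. (1 / real M ^ m) powr t < e" using e by (rule order_tendstoD)
  then have "\<forall>\<^sub>F m in sequentially. (1 / real M ^ m) powr t < e \<and> m \<ge> m0"
    by (intro eventually_conj eventually_ge_at_top)
  then obtain m where "(1 / real M ^ m) powr t < e" "m \<ge> m0" using eventually_happens by fastforce
  then show ?thesis using that[of m] True M by simp
next
  case False
  then have d0: "d > 0" using d by simp
  \<comment> \<open>The first level at which the strict inequality fails. Its predecessor is the
    \<open>m\<close> sought, since the failure bounds \<open>1 / real M ^ m\<close> by
    \<open>real M * d\<close>.\<close>
  define k where "k = (LEAST k. \<not> d < 1 / real M ^ k)"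
  obtain n where "1 / d < real M ^ n" using real_arch_pow[of "real M" "1 / d"] M by auto
  then have ex: "\<not> d < 1 / real M ^ n" using d0 M by (simp add: field_simps not_less)
  have k: "\<not> d < 1 / real M ^ k" unfolding k_def by (rule LeastI[of _ n]) (rule ex)
  have less: "d < 1 / real M ^ j" if "j < k" for j using not_less_Least[of j] that unfolding k_def by blast
  have "m0 < k"
  proof (rule ccontr)
    assume "\<not> m0 < k"
    then have "1 / real M ^ m0 \<le> 1 / real M ^ k" using M by (intro divide_left_mono power_increasing) auto
    then show False using k d by simp
  qed
  then obtain m where m: "k = Suc m" "m \<ge> m0" by (cases k) auto
  have "1 / real M ^ m = real M * (1 / real M ^ k)" using M by (simp add: m)
  also have "\<dots> \<le> real M * d" using k by (intro mult_left_mono) auto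
  finally have "(1 / real M ^ m) powr t \<le> (real M * d) powr t" using t by (intro powr_mono2) auto
  also have "\<dots> = real M powr t * d powr t" using d0 by (simp add: powr_mult)
  finally show ?thesis using that[of m] m less[of m] e by simp
qed

context percolation
begin

text \<open>Counting at one typical level replaces a limit measure. By \<open>st\<close> a tube of
  level \<open>m\<close> holds at most \<open>lam ^ n * (1 / real M ^ m) powr t\<close> retained
  cells, so a cheap cover cannot account for \<open>c * lam ^ n\<close> of them. The gap
  \<open>t' < t\<close> keeps \<open>t\<close> positive even for \<open>t' = 0\<close>.\<close>

lemma positive_hausdorff_measure_projection:
  fixes f :: "real^2 \<Rightarrow> 'b::metric_space"
  assumes u: "norm u = 1" and f: "\<And>x y. dist (f x) (f y) = \<bar>(x - y) \<bullet> u\<bar>"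
    and lam: "lam > 0" and s: "s > 0" and t: "0 \<le> t'" "t' < t" and st: "s * mu \<le> lam * (1 / real M) powr t"
    and c: "c > 0" and freq: "\<exists>\<^sub>F n in sequentially. typical s c m0 n (ret n \<omega>)"
  shows "hausdorff_measure t' (f ` percolation_set M R \<omega>) \<noteq> 0"
proof
  assume null: "hausdorff_measure t' (f ` percolation_set M R \<omega>) = 0"
  define E where "E = percolation_set M R \<omega>"
  \<comment> \<open>Makes the final estimate read
    \<open>c \<le> (real M powr t + 1) * \<eta> = c / 2\<close>. The summand 1 pays for the errors
    \<open>\<eta> * (1 / 2) ^ Suc k\<close> of the choice of scales.\<close>
  define \<eta> where "\<eta> = c / (2 * (real M powr t + 1))"
  have Mt: "real M powr t > 0" using M_pos by simp
  have Mt1: "real M powr t + 1 > 0" using Mt by linarith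
  have \<eta>: "\<eta> > 0" unfolding \<eta>_def by (intro divide_pos_pos mult_pos_pos c Mt1) simp
  \<comment> \<open>Tube control starts at \<open>m0\<close>, and the inclusion of the percolation
    set in a level is used from 1 on.\<close>
  define l0 where "l0 = max m0 1"
  define \<delta> where "\<delta> = 1 / real M ^ Suc l0"
  have "real M ^ l0 < real M ^ Suc l0" using M_ge_2 by (intro power_strict_increasing) auto
  moreover have "real M ^ Suc l0 \<ge> 1" using M_ge_2 by (intro one_le_power) simp
  moreover have "real M ^ l0 > 0" using M_pos by simp
  ultimately have \<delta>: "\<delta> > 0" "\<delta> < 1 / real M ^ l0" "\<delta> \<le> 1"
    unfolding \<delta>_def by (auto intro!: divide_strict_left_mono simp del: power_Suc)
  obtain C where C: "f ` E \<subseteq> (\<Union>k. C k)" "\<And>k. bounded (C k)" "\<And>k. diameter (C k) \<le> \<delta>"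
    and sum_C: "(\<Sum>k. diam_pow t' (C k)) < ennreal \<eta>"
    using null_hausdorff_measure_cover[OF null \<delta>(1), of "ennreal \<eta>"] \<eta> unfolding E_def by auto
  \<comment> \<open>Only members that meet the image are kept; each supplies a point of
    \<open>E\<close> on which a strip is centred.\<close>
  define I where "I = {k. \<exists>x\<in>E. f x \<in> C k}"
  have "\<exists>m. m \<ge> l0 \<and> diameter (C k) < 1 / real M ^ m \<and>
      (1 / real M ^ m) powr t \<le> real M powr t * diameter (C k) powr t + \<eta> * (1 / 2) ^ Suc k" for k
  proof -
    have t0: "t > 0" using t by simp
    have e0: "\<eta> * (1 / 2) ^ Suc k > 0" using \<eta> by simp
    have "diameter (C k) < 1 / real M ^ l0" using C(3)[of k] \<delta>(2) by linarith
    from scale_choice[OF M_ge_2 t0 diameter_ge_0[OF C(2)] this e0] show ?thesis by blast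
  qed
  then obtain lev where lev: "\<And>k. lev k \<ge> l0" "\<And>k. diameter (C k) < 1 / real M ^ lev k"
      "\<And>k. (1 / real M ^ lev k) powr t \<le> real M powr t * diameter (C k) powr t + \<eta> * (1 / 2) ^ Suc k"
    by metis
  have "\<forall>k\<in>I. \<exists>x. x \<in> E \<and> f x \<in> C k" by (auto simp: I_def)
  then obtain x where x: "\<And>k. k \<in> I \<Longrightarrow> x k \<in> E" "\<And>k. k \<in> I \<Longrightarrow> f (x k) \<in> C k" by metis
  have "\<exists>q tt. q \<in> ret (lev k) \<omega> \<and> x k \<in> square M (lev k) q \<and> tt \<in> tube_params M (lev k) \<and>
      (\<forall>y q'. y \<in> square M (lev k) q' \<longrightarrow> q' \<in> grid M (lev k) \<longrightarrow> \<bar>(y - x k) \<bullet> u\<bar> \<le> 1 / real M ^ lev k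
         \<longrightarrow> q' \<in> tube M (lev k) tt)" if k: "k \<in> I" for k
  proof -
    have "lev k \<ge> 1" using lev(1)[of k] by (simp add: l0_def)
    then have "x k \<in> percolation_level M R \<omega> (lev k)"
      using percolation_set_subset_level[of "lev k" M R \<omega>] x(1)[OF k] unfolding E_def by auto
    then obtain q where q: "q \<in> ret (lev k) \<omega>" "x k \<in> square M (lev k) q"
      by (auto simp: percolation_level_def)
    then have qg: "q \<in> grid M (lev k)" using retained_subset_grid[OF M_pos, of R \<omega> "lev k"] by auto
    obtain tt where "tt \<in> tube_params M (lev k)"
      "\<And>x y q'. x \<in> square M (lev k) q \<Longrightarrow> y \<in> square M (lev k) q' \<Longrightarrow> q' \<in> grid M (lev k) \<Longrightarrow> \<bar>(y - x) \<bullet> u\<bar> \<le> 1 / real M ^ lev k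
         \<Longrightarrow> q' \<in> tube M (lev k) tt"
      by (rule tube_of_strip[OF M_pos u qg]) (rule that)
    then show ?thesis using q by blast
  qed
  then obtain tt where tt: "\<And>k. k \<in> I \<Longrightarrow> tt k \<in> tube_params M (lev k)"
    "\<And>k y q'. k \<in> I \<Longrightarrow> y \<in> square M (lev k) q' \<Longrightarrow> q' \<in> grid M (lev k) \<Longrightarrow>
       \<bar>(y - x k) \<bullet> u\<bar> \<le> 1 / real M ^ lev k \<Longrightarrow> q' \<in> tube M (lev k) (tt k)"
    by metis
  \<comment> \<open>Open, so that compactness applies, and wide enough to contain every point of
    \<open>E\<close> that \<open>f\<close> maps into \<open>C k\<close>.\<close>
  define U where "U k = {y. \<bar>(y - x k) \<bullet> u\<bar> < 1 / real M ^ lev k}" for k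
  have "open (U k)" for k
    unfolding U_def by (intro open_Collect_less continuous_intros)
  moreover have "E \<subseteq> (\<Union>k\<in>I. U k)"
  proof
    fix y assume y: "y \<in> E"
    then obtain k where k: "f y \<in> C k" using C(1) by blast
    then have kI: "k \<in> I" using y by (auto simp: I_def)
    have "\<bar>(y - x k) \<bullet> u\<bar> = dist (f y) (f (x k))" by (simp add: f)
    also have "\<dots> \<le> diameter (C k)" by (rule diameter_bounded_bound[OF C(2) k x(2)[OF kI]])
    finally show "y \<in> (\<Union>k\<in>I. U k)" using lev(2)[of k] by (intro UN_I[OF kI]) (simp add: U_def)
  qed
  ultimately obtain K where K: "K \<subseteq> I" "finite K" "E \<subseteq> (\<Union>k\<in>K. U k)"
    using compactE_image[OF compact_percolation_set[OF M_pos], of I U R \<omega>] unfolding E_def by metis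
  have "open (\<Union>k\<in>K. U k)" using \<open>\<And>k. open (U k)\<close> by (intro open_UN) auto
  then obtain N where N: "\<And>n. n \<ge> N \<Longrightarrow> percolation_level M R \<omega> n \<subseteq> (\<Union>k\<in>K. U k)"
    using percolation_level_subset_open[OF M_pos _ K(3)[unfolded E_def]] by metis
  \<comment> \<open>From \<open>N\<close> on a level lies inside the finitely many strips, and cells
    need ancestors at every strip level in use. This threshold depends on the cover, hence the
    demand for infinitely many typical levels.\<close>
  define L where "L = Max (insert N (lev ` K))"
  obtain n where n: "n \<ge> L" "typical s c m0 n (ret n \<omega>)"
    using freq unfolding frequently_def eventually_sequentially by blast
  have nN: "n \<ge> N" and nlev: "\<And>k. k \<in> K \<Longrightarrow> lev k \<le> n"
    using n(1) K(2) unfolding L_def by auto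
  have sub: "ret n \<omega> \<subseteq> (\<Union>k\<in>K. tube_desc (lev k) n (tt k) \<inter> ret n \<omega>)"
  proof
    fix q assume q: "q \<in> ret n \<omega>"
    \<comment> \<open>One point of the square suffices: it lies in some strip, so the ancestor of
      \<open>q\<close> at the level of that strip belongs to its tube.\<close>
    obtain y where y: "y \<in> square M n q" using square_nonempty[OF M_pos] by blast
    then have "y \<in> percolation_level M R \<omega> n" using q by (auto simp: percolation_level_def)
    then obtain k where k: "k \<in> K" "y \<in> U k" using N[OF nN] by blast
    have qg: "q \<in> grid M n" using q retained_subset_grid[OF M_pos, of R \<omega> n] by auto
    have nl: "n - (n - lev k) = lev k" using nlev[OF k(1)] by simp
    have "y \<in> square M (lev k) (anc M (n - lev k) q)"
      using square_anc[OF M_pos _ y, of "n - lev k"] nl by simp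
    moreover have "anc M (n - lev k) q \<in> grid M (lev k)"
      using anc_in_grid[OF qg _ M_pos, of "n - lev k"] nl by simp
    ultimately have "anc M (n - lev k) q \<in> tube M (lev k) (tt k)"
      using k K(1) by (intro tt(2)) (auto simp: U_def)
    then show "q \<in> (\<Union>k\<in>K. tube_desc (lev k) n (tt k) \<inter> ret n \<omega>)"
      using k(1) q qg by (auto simp: tube_desc_def)
  qed
  have "c * lam ^ n \<le> real (card (ret n \<omega>))" using n(2) by (simp add: typical_def)
  also have "\<dots> \<le> real (card (\<Union>k\<in>K. tube_desc (lev k) n (tt k) \<inter> ret n \<omega>))"
    by (intro of_nat_mono card_mono[OF _ sub] finite_UN_I finite_Int disjI2 K(2) finite_retained[OF M_pos])
  also have "\<dots> \<le> (\<Sum>k\<in>K. real (card (tube_desc (lev k) n (tt k) \<inter> ret n \<omega>)))"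
    unfolding of_nat_sum[symmetric] using K(2) by (intro of_nat_mono card_UN_le)
  also have "\<dots> \<le> (\<Sum>k\<in>K. lam ^ n * (1 / real M ^ lev k) powr t)"
  proof (intro sum_mono)
    fix k assume k: "k \<in> K"
    have "lev k \<in> {m0..n}" using lev(1)[of k] nlev[OF k] by (simp add: l0_def)
    then have "real (card (tube_desc (lev k) n (tt k) \<inter> ret n \<omega>)) \<le> (s * mu) ^ lev k * lam ^ (n - lev k)"
      using n(2) tt(1) k K(1) unfolding typical_def by blast
    also have "\<dots> \<le> (lam * (1 / real M) powr t) ^ lev k * lam ^ (n - lev k)"
      using st s mu_ge_1 lam by (intro mult_right_mono power_mono) auto
    also have "\<dots> = (lam ^ lev k * lam ^ (n - lev k)) * ((1 / real M) powr t) ^ lev k"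
      by (simp add: power_mult_distrib)
    also have "lam ^ lev k * lam ^ (n - lev k) = lam ^ n" using nlev[OF k] by (simp flip: power_add)
    also have "((1 / real M) powr t) ^ lev k = (1 / real M ^ lev k) powr t"
      using M_pos by (simp add: powr_power power_one_over flip: powr_realpow powr_powr)
        (simp add: powr_powr powr_divide powr_realpow[symmetric] mult.commute)
    finally show "real (card (tube_desc (lev k) n (tt k) \<inter> ret n \<omega>)) \<le> lam ^ n * (1 / real M ^ lev k) powr t" .
  qed
  also have "\<dots> = lam ^ n * (\<Sum>k\<in>K. (1 / real M ^ lev k) powr t)" by (simp add: sum_distrib_left)
  finally have "c \<le> (\<Sum>k\<in>K. (1 / real M ^ lev k) powr t)"
    using lam by (simp add: mult.commute)
  also have "\<dots> \<le> (\<Sum>k\<in>K. real M powr t * diameter (C k) powr t + \<eta> * (1 / 2) ^ Suc k)"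
    by (intro sum_mono lev(3))
  also have "\<dots> = real M powr t * (\<Sum>k\<in>K. diameter (C k) powr t) + \<eta> * (\<Sum>k\<in>K. (1 / 2) ^ Suc k)"
    by (simp add: sum.distrib sum_distrib_left)
  finally have c_le: "c \<le> real M powr t * (\<Sum>k\<in>K. diameter (C k) powr t) + \<eta> * (\<Sum>k\<in>K. (1 / 2) ^ Suc k)" .
  have sum_diam: "(\<Sum>k\<in>K. diameter (C k) powr t) \<le> \<eta>"
  proof -
    have "ennreal (\<Sum>k\<in>K. diameter (C k) powr t) = (\<Sum>k\<in>K. ennreal (diameter (C k) powr t))" by simp
    also have "\<dots> \<le> (\<Sum>k\<in>K. diam_pow t' (C k))"
    proof (intro sum_mono)
      fix k assume "k \<in> K"
      then have "C k \<noteq> {}" using K(1) by (auto simp: I_def)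
      \<comment> \<open>Diameters are at most 1, so lowering the exponent enlarges the power. A
        member of diameter 0 contributes \<open>0 powr t = 0\<close>.\<close>
      moreover have "diameter (C k) powr t \<le> (if t' = 0 then 1 else diameter (C k) powr t')"
      proof (cases "diameter (C k) = 0")
        case False
        then have "0 < diameter (C k)" "diameter (C k) \<le> 1"
          using diameter_ge_0[OF C(2), of k] C(3)[of k] \<delta>(3) by auto
        then have "diameter (C k) powr t \<le> diameter (C k) powr t'" using t by (intro powr_mono') auto
        then show ?thesis using \<open>0 < diameter (C k)\<close> by auto
      qed simp
      ultimately show "ennreal (diameter (C k) powr t) \<le> diam_pow t' (C k)"
        by (auto simp: diam_pow_def intro!: ennreal_leI split: if_splits)
    qed
    also have "\<dots> \<le> (\<Sum>k. diam_pow t' (C k))" using K(2) by (intro sum_le_suminf) auto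
    also have "\<dots> < ennreal \<eta>" by (rule sum_C)
    finally show ?thesis using \<eta> by (simp add: ennreal_less_iff sum_nonneg)
  qed
  have sum_half: "(\<Sum>k\<in>K. (1 / 2 :: real) ^ Suc k) \<le> 1"
  proof -
    have "(\<Sum>k\<in>K. (1 / 2 :: real) ^ Suc k) \<le> (\<Sum>k. (1 / 2) ^ Suc k)"
      using K(2) power_half_series by (intro sum_le_suminf) (auto simp: sums_iff)
    then show ?thesis using power_half_series by (simp add: sums_iff)
  qed
  have "c \<le> real M powr t * \<eta> + \<eta> * 1"
    using c_le mult_left_mono[OF sum_diam less_imp_le[OF Mt]] mult_left_mono[OF sum_half less_imp_le[OF \<eta>]]
    by linarith
  also have "\<dots> = (real M powr t + 1) * \<eta>" by (simp add: algebra_simps)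
  also have "\<dots> = c / 2" 
  proof -
    have "a * (c / (2 * a)) = c / 2" if "a > 0" for a :: real using that by simp
    then show ?thesis unfolding \<eta>_def using Mt1 by blast
  qed
  finally show False using c by simp
qed

section \<open>Dimension bounds and their combination\<close>

text \<open>The weighted count has mean \<open>(lam * r) ^ n\<close>, which tends to 0. By Markov's
  inequality at ever larger single \<open>n\<close>, staying above a fixed positive value from some
  level on has probability 0.\<close>

lemma AE_few_squares:
  assumes r: "r > 0" "lam * r < 1"
  shows "AE \<omega> in P. \<forall>e>0. \<forall>N. \<exists>n\<ge>N. real (card (ret n \<omega>)) * r ^ n \<le> e"
proof -
  have markov: "prob {\<omega> \<in> space P. real (card (ret n \<omega>)) * r ^ n > e} \<le> (lam * r) ^ n / e" if e: "e > 0" for n e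
  proof -
    define A where "A = {\<omega> \<in> space P. real (card (ret n \<omega>)) * r ^ n > e}"
    have A [measurable]: "A \<in> events" unfolding A_def by (rule ret_event)
    have "space P \<in> past 0" using ret_past[of 0 0 "\<lambda>_. True"] by simp
    then have "first_moment (space P) n = lam ^ n * first_moment (space P) 0" using first_moment_add[of "space P" 0 n] by simp
    moreover have "first_moment (space P) 0 = 1"
      unfolding first_moment_def by (subst Bochner_Integration.integral_cong[OF refl, of _ _ "\<lambda>_. 1"]) (auto simp: prob_space)
    ultimately have m1: "first_moment (space P) n = lam ^ n" by simp
    have "e * prob A = expectation (\<lambda>\<omega>. e * indicator A \<omega>)" by simp
    also have "\<dots> \<le> expectation (\<lambda>\<omega>. r ^ n * (indicator (space P) \<omega> * real (card (ret n \<omega>))))"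
    proof (intro integral_mono)
      show "integrable P (\<lambda>\<omega>. e * indicator A \<omega>)" by (simp add: less_top[symmetric])
      show "integrable P (\<lambda>\<omega>. r ^ n * (indicator (space P) \<omega> * real (card (ret n \<omega>))))"
        by (intro integrable_mult_right ret_integrable) simp
      show "e * indicator A \<omega> \<le> r ^ n * (indicator (space P) \<omega> * real (card (ret n \<omega>)))" for \<omega>
        using r by (auto simp: indicator_def A_def mult.commute)
    qed
    also have "\<dots> = r ^ n * first_moment (space P) n" unfolding first_moment_def by simp
    finally show ?thesis using e by (simp add: A_def m1 power_mult_distrib pos_le_divide_eq mult.commute)
  qed
  have ae: "AE \<omega> in P. \<exists>n\<ge>N. real (card (ret n \<omega>)) * r ^ n \<le> 1 / real (Suc j)" for N j
  proof -
    define e where "e = 1 / real (Suc j)"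
    have e: "e > 0" by (simp add: e_def)
    define B where "B = {\<omega> \<in> space P. \<forall>n\<ge>N. \<not> real (card (ret n \<omega>)) * r ^ n \<le> e}"
    have B: "B \<in> events"
      unfolding B_def
    proof (rule sets.sets_Collect_countable_All)
      show "{\<omega> \<in> space P. n \<ge> N \<longrightarrow> \<not> real (card (ret n \<omega>)) * r ^ n \<le> e} \<in> events" for n
        by (rule ret_event)
    qed
    have "prob B \<le> (lam * r) ^ n / e" if "n \<ge> N" for n
    proof -
      have "prob B \<le> prob {\<omega> \<in> space P. real (card (ret n \<omega>)) * r ^ n > e}"
      proof (rule finite_measure_mono)
        show "B \<subseteq> {\<omega> \<in> space P. real (card (ret n \<omega>)) * r ^ n > e}"
          using that by (auto simp: B_def not_le)
        show "{\<omega> \<in> space P. real (card (ret n \<omega>)) * r ^ n > e} \<in> events" by (rule ret_event)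
      qed
      then show ?thesis using markov[OF e, of n] by linarith
    qed
    moreover have "(\<lambda>n. (lam * r) ^ n / e) \<longlonglongrightarrow> 0"
      using r lam_pos by (intro tendsto_divide_zero LIMSEQ_realpow_zero) auto
    ultimately have "prob B \<le> 0" by (intro LIMSEQ_le_const) auto
    then have "prob B = 0" using measure_nonneg[of P B] by linarith
    then have "B \<in> null_sets P" using B by (intro null_setsI) (auto simp: emeasure_eq_measure)
    then have "AE \<omega> in P. \<omega> \<notin> B" by (rule AE_not_in)
    then show ?thesis
      using AE_space by eventually_elim (auto simp: B_def e_def)
  qed
  have "AE \<omega> in P. \<forall>N j. \<exists>n\<ge>N. real (card (ret n \<omega>)) * r ^ n \<le> 1 / real (Suc j)"
    unfolding AE_all_countable using ae by blast
  then show ?thesis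
  proof eventually_elim
    case (elim \<omega>)
    show ?case
    proof (intro allI impI)
      fix e :: real and N :: nat assume "e > 0"
      then obtain j where j: "inverse (real (Suc j)) < e" using reals_Archimedean by blast
      obtain n where "n \<ge> N" "real (card (ret n \<omega>)) * r ^ n \<le> 1 / real (Suc j)" using elim by blast
      then show "\<exists>n\<ge>N. real (card (ret n \<omega>)) * r ^ n \<le> e"
        using j by (intro exI[of _ n]) (auto simp: inverse_eq_divide)
    qed
  qed
qed

text \<open>Uses \<open>r = (1 / real M) powr t\<close> for \<open>t\<close> slightly above
  \<open>\<sigma>\<close>. It serves \<open>\<sigma> = log (real M) lam\<close> when
  \<open>lam > 1\<close> and \<open>\<sigma> = 0\<close> otherwise.\<close>

lemma AE_dim_le:
  assumes \<sigma>: "\<sigma> \<ge> 0" "lam \<le> real M powr \<sigma>"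
  shows "AE \<omega> in P. hausdorff_dim (percolation_set M R \<omega>) \<le> ennreal \<sigma>"
proof -
  have ae: "AE \<omega> in P. hausdorff_dim (percolation_set M R \<omega>) \<le> ennreal (\<sigma> + 1 / real (Suc j))" for j
  proof -
    define t where "t = \<sigma> + 1 / real (Suc j)"
    have t: "t > \<sigma>" "t > 0" using \<sigma> by (auto simp: t_def add_nonneg_pos)
    define r where "r = (1 / real M) powr t"
    have r0: "r > 0" using M_pos by (simp add: r_def)
    have "lam * r \<le> real M powr \<sigma> * r" using \<sigma>(2) r0 by (intro mult_right_mono) auto
    also have "\<dots> = real M powr (\<sigma> - t)" using M_pos by (simp add: r_def powr_divide powr_diff)
    also have "\<dots> < 1" using M_ge_2 t by (intro powr_less_one) auto
    finally have "lam * r < 1" .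
    from AE_few_squares[OF r0 this] show ?thesis
    proof eventually_elim
      case (elim \<omega>)
      have "r ^ n = (1 / real M ^ n) powr t" for n
        using M_pos by (simp add: r_def powr_divide powr_power powr_realpow[symmetric] powr_powr power_divide mult.commute)
      then have "hausdorff_measure t (percolation_set M R \<omega>) = 0"
        using elim by (intro null_percolation_set M_pos t M_ge_2) auto
      then show ?case
        unfolding hausdorff_dim_def t_def[symmetric] using t by (intro INF_lower) auto
    qed
  qed
  have "AE \<omega> in P. \<forall>j. hausdorff_dim (percolation_set M R \<omega>) \<le> ennreal (\<sigma> + 1 / real (Suc j))"
    unfolding AE_all_countable using ae by blast
  then show ?thesis
  proof eventually_elim
    case (elim \<omega>)
    show ?case
    proof (rule ennreal_le_epsilon)
      fix e :: real assume "e > 0"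
      then obtain j where "inverse (real (Suc j)) < e" using reals_Archimedean by blast
      then have "ennreal (\<sigma> + 1 / real (Suc j)) \<le> ennreal (\<sigma> + e)"
        by (intro ennreal_leI) (simp add: inverse_eq_divide)
      also have "\<dots> = ennreal \<sigma> + ennreal e" using \<sigma>(1) \<open>e > 0\<close> by (simp add: ennreal_plus)
      finally show "hausdorff_dim (percolation_set M R \<omega>) \<le> ennreal \<sigma> + ennreal e"
        using elim order_trans by blast
    qed
  qed
qed

text \<open>The exceptional null set comes from typicality, which mentions no line, so it is fixed
  before \<open>L\<close> is chosen.\<close>

lemma AE_dim_projection_ge:
  assumes lam: "lam > 1"
  shows "AE \<omega> in P. percolation_set M R \<omega> \<noteq> {} \<longrightarrow>
    (\<forall>L :: (real^2) set. is_line L \<longrightarrow>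
      ennreal (min 1 (log (real M) lam)) \<le> hausdorff_dim (orth_proj L ` percolation_set M R \<omega>))"
proof -
  define \<tau> where "\<tau> = min 1 (log (real M) lam)"
  have M1: "real M > 1" using M_ge_2 by simp
  \<comment> \<open>Since \<open>mu = lam * max (1 / lam) (1 / real M)\<close>, the two cases of the
    maximum match those of the minimum in \<open>\<tau>\<close>.\<close>
  have mu: "mu = lam * (1 / real M) powr \<tau>"
  proof -
    have "mu = lam * max (1 / lam) (1 / real M)"
      using lam M1 p_pos by (simp add: mu_def lam_def max_mult_distrib_left power2_eq_square)
    also have "max (1 / lam) (1 / real M) = (1 / real M) powr \<tau>"
    proof (cases "log (real M) lam \<le> 1")
      case True
      then have "lam \<le> real M" using lam M1 by (simp add: log_le_iff)
      then have "1 / real M \<le> 1 / lam" using lam by (intro divide_left_mono) auto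
      then have "max (1 / lam) (1 / real M) = 1 / lam" by (rule max_absorb1)
      then show ?thesis using True lam M1 by (simp add: \<tau>_def powr_divide)
    next
      case False
      then have "lam \<ge> real M" using lam M1 by (simp add: log_le_iff)
      then have "1 / lam \<le> 1 / real M" using M1 by (intro divide_left_mono) auto
      then have "max (1 / lam) (1 / real M) = 1 / real M" by (rule max_absorb2)
      then show ?thesis using False M1 by (simp add: \<tau>_def powr_divide)
    qed
    finally show ?thesis .
  qed
  have "AE \<omega> in P. \<forall>j. (\<forall>m. ret m \<omega> \<noteq> {}) \<longrightarrow>
    (\<exists>c>0. \<exists>m0. \<exists>\<^sub>F n in sequentially. typical (real M powr (1 / real (Suc j))) c m0 n (ret n \<omega>))"
    unfolding AE_all_countable using M1 by (intro allI AE_frequently_typical lam) (simp add: gr_one_powr)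
  then show ?thesis
  proof eventually_elim
    case (elim \<omega>)
    show ?case
    proof (intro impI allI)
      fix L :: "(real^2) set"
      assume ne: "percolation_set M R \<omega> \<noteq> {}" and L: "is_line L"
      obtain a u where u: "norm u = 1" and proj: "\<And>x. orth_proj L x = a + ((x - a) \<bullet> u) *\<^sub>R u"
        using orth_proj_line[OF L] by blast
      have f: "dist (orth_proj L x) (orth_proj L y) = \<bar>(x - y) \<bullet> u\<bar>" for x y
      proof -
        have "orth_proj L x - orth_proj L y = ((x - y) \<bullet> u) *\<^sub>R u"
          by (simp add: proj inner_diff_left algebra_simps)
        then show ?thesis by (simp add: dist_norm u)
      qed
      have "ennreal \<tau> \<le> hausdorff_dim (orth_proj L ` percolation_set M R \<omega>)"
      proof (rule hausdorff_dim_geI)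
        fix t' assume t': "0 \<le> t'" "t' < \<tau>"
        obtain j where j: "inverse (real (Suc j)) < \<tau> - t'" using reals_Archimedean[of "\<tau> - t'"] t' by auto
        \<comment> \<open>The exponent gives up exactly the slack
          \<open>s = real M powr (1 / real (Suc j))\<close>, so the condition on
          \<open>s * mu\<close> holds with equality.\<close>
        define t where "t = \<tau> - 1 / real (Suc j)"
        have t: "t' < t" using j by (simp add: t_def inverse_eq_divide)
        obtain c m0 where freq: "c > 0"
          "\<exists>\<^sub>F n in sequentially. typical (real M powr (1 / real (Suc j))) c m0 n (ret n \<omega>)"
          using elim retained_nonempty[OF ne] by blast
        have "real M powr (1 / real (Suc j)) * mu = lam * (1 / real M) powr t"
          using M1 by (simp add: mu t_def powr_divide powr_diff)
        then show "hausdorff_measure t' (orth_proj L ` percolation_set M R \<omega>) \<noteq> 0"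
          using lam M_pos t' t freq by (intro positive_hausdorff_measure_projection[OF u f, of "real M powr (1 / real (Suc j))" t' t c m0]) auto
      qed
      then show "ennreal (min 1 (log (real M) lam)) \<le> hausdorff_dim (orth_proj L ` percolation_set M R \<omega>)"
        by (simp add: \<tau>_def)
    qed
  qed
qed

text \<open>Holds for every outcome: the projection is a contraction, and it maps the bounded
  percolation set into a segment.\<close>

lemma dim_projection_le:
  fixes L :: "(real^2) set"
  assumes L: "is_line L"
  shows "hausdorff_dim (orth_proj L ` percolation_set M R \<omega>) \<le> min 1 (hausdorff_dim (percolation_set M R \<omega>))"
proof -
  obtain a u where u: "norm u = 1" and proj: "\<And>x. orth_proj L x = a + ((x - a) \<bullet> u) *\<^sub>R u"
    using orth_proj_line[OF L] by blast
  have f: "dist (orth_proj L x) (orth_proj L y) \<le> dist x y" for x y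
  proof -
    have "orth_proj L x - orth_proj L y = ((x - y) \<bullet> u) *\<^sub>R u"
      by (simp add: proj inner_diff_left algebra_simps)
    then show ?thesis using Cauchy_Schwarz_ineq2[of "x - y" u] by (simp add: dist_norm u)
  qed
  have "bounded (percolation_set M R \<omega>)"
    by (rule compact_imp_bounded[OF compact_percolation_set[OF M_pos]])
  then obtain b where b: "\<And>x. x \<in> percolation_set M R \<omega> \<Longrightarrow> dist a x \<le> b"
    unfolding bounded_any_center[of _ a] by auto
  have "orth_proj L ` percolation_set M R \<omega> \<subseteq> (\<lambda>r. a + r *\<^sub>R u) ` {-b..b}"
  proof
    fix y assume "y \<in> orth_proj L ` percolation_set M R \<omega>"
    then obtain x where x: "x \<in> percolation_set M R \<omega>" "y = a + ((x - a) \<bullet> u) *\<^sub>R u"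
      by (auto simp: proj)
    have "\<bar>(x - a) \<bullet> u\<bar> \<le> b"
      using Cauchy_Schwarz_ineq2[of "x - a" u] b[OF x(1)] by (simp add: dist_norm norm_minus_commute u)
    then show "y \<in> (\<lambda>r. a + r *\<^sub>R u) ` {-b..b}" 
      unfolding x(2) by (intro imageI) (simp add: abs_le_iff)
  qed
  then have "hausdorff_dim (orth_proj L ` percolation_set M R \<omega>) \<le> 1"
    by (rule hausdorff_dim_line_subset_le_1[OF u])
  then show ?thesis using hausdorff_dim_image_le[OF f] by simp
qed

text \<open>For \<open>lam > 1\<close> the upper bound for the set and the lower bound for its
  projections meet. For \<open>lam \<le> 1\<close> the set almost surely has dimension 0, which
  projecting cannot raise.\<close>

lemma AE_dim_projection_eq:
  "AE \<omega> in P. percolation_set M R \<omega> \<noteq> {} \<longrightarrow> (\<forall>L :: (real^2) set. is_line L \<longrightarrow>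
    hausdorff_dim (orth_proj L ` percolation_set M R \<omega>) = min 1 (hausdorff_dim (percolation_set M R \<omega>)))"
proof (cases "lam > 1")
  case True
  have M1: "real M > 1" using M_ge_2 by simp
  have "AE \<omega> in P. hausdorff_dim (percolation_set M R \<omega>) \<le> ennreal (log (real M) lam)"
    using True M1 by (intro AE_dim_le) auto
  with AE_dim_projection_ge[OF True] show ?thesis
  proof eventually_elim
    case (elim \<omega>)
    have "min 1 (hausdorff_dim (percolation_set M R \<omega>)) \<le> min 1 (ennreal (log (real M) lam))"
      using elim(2) by (intro min.mono) auto
    also have "\<dots> = ennreal (min 1 (log (real M) lam))"
    proof (cases "log (real M) lam \<le> 1")
      case True
      then show ?thesis by (simp add: min_absorb2 ennreal_le_1)
    next
      case False
      then have "1 \<le> ennreal (log (real M) lam)" using ennreal_leI[of 1 "log (real M) lam"] by simp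
      then show ?thesis using False by (simp add: min_absorb1)
    qed
    finally have le: "min 1 (hausdorff_dim (percolation_set M R \<omega>)) \<le> ennreal (min 1 (log (real M) lam))" .
    show ?case
    proof (intro impI allI antisym dim_projection_le)
      fix L :: "(real^2) set"
      assume "percolation_set M R \<omega> \<noteq> {}" "is_line L"
      with elim(1) le show "min 1 (hausdorff_dim (percolation_set M R \<omega>)) \<le> hausdorff_dim (orth_proj L ` percolation_set M R \<omega>)"
        by (auto intro: order_trans)
    qed
  qed
next
  case False
  have "AE \<omega> in P. hausdorff_dim (percolation_set M R \<omega>) \<le> ennreal 0"
    using False M_pos by (intro AE_dim_le) auto
  then show ?thesis
  proof eventually_elim
    case (elim \<omega>)
    then have "hausdorff_dim (percolation_set M R \<omega>) = 0" by simp
    then show ?case using dim_projection_le[of _ \<omega>] by simp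
  qed
qed

end

theorem theorem2:
  fixes M :: nat and p :: real
    and P :: "'w measure" and R :: "nat \<times> nat \<times> nat \<Rightarrow> 'w set"
  assumes "M \<ge> 2" and "0 < p" and "p \<le> 1"
    and "percolation_coins M p P R"
  shows "AE \<omega> in P. percolation_set M R \<omega> \<noteq> {} \<longrightarrow>
    (\<forall>L :: (real^2) set.
       is_line L \<and> (\<forall>k::2. \<not> affine_parallel L (span {axis k 1})) \<longrightarrow>
       hausdorff_dim (orth_proj L ` percolation_set M R \<omega>)
         = min 1 (hausdorff_dim (percolation_set M R \<omega>)))"
proof -
  interpret prob_space P using assms(4) by (simp add: percolation_coins_def)
  interpret percolation P M p R
    using assms by unfold_locales (auto simp: percolation_coins_def)
  show ?thesis using AE_dim_projection_eq by eventually_elim simp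
qed

end
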